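(* Let $a\ge2$ be an integer. The set $\mathcal{G}_a$ induces a periodic tiling of the complex plane, that is: (a) $\mathbb{C}=\bigcup_{u\in\mathbb{Z}+\mathbb{Z}\alpha}(\mathcal{G}_a+u)$; (b) for $u,v\in\mathbb{Z}+\mathbb{Z}\alpha$, if $\operatorname{int}(\mathcal{G}_a+u)\cap(\mathcal{G}_a+v)\neq\emptyset$ then $u=v$.
   Context: Let $a\ge2$ be an integer and write $x^3-ax^2+x-1=(x-\beta)(x-\alpha)(x-\gamma)$ with $\beta>1$ real and $\alpha,\gamma\in\mathbb{C}\setminus\mathbb{R}$ complex conjugates, $|\alpha|<1$. $<_{lex}$ is the lexicographic order on finite words of equal length over $\{0,\dots,a-1\}$. $\mathcal{G}_a$ is the set of all $\sum_{i=2}^\infty a_i\alpha^i$ such that for all $N\ge2$ the word $(a_i)_{2\le i\le N}$ is a greedy $G$-expansion, i.e. $a_i\in\{0,\dots,a-1\}$, $a_ia_{i-1}a_{i-2}a_{i-3}<_{lex}(a-1)(a-1)01$ for all $i\ge5$, and $a_3a_2<_{lex}(a-1)(a-1)$, $a_4a_3a_2<_{lex}(a-1)(a-1)0$. $\operatorname{int}$ denotes topological interior in $\mathbb{C}$. *)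

theory Defs
  imports "HOL-Analysis.Analysis" "HOL-Computational_Algebra.Polynomial"
begin

text \<open>The relation \<open>lex less_than\<close> relates only words of equal length.\<close>

abbreviation lex_less :: "nat list \<Rightarrow> nat list \<Rightarrow> bool"  (infix "<\<^sub>l\<^sub>e\<^sub>x" 50)
  where "v <\<^sub>l\<^sub>e\<^sub>x w \<equiv> (v, w) \<in> lex less_than"

text \<open>The word \<open>(d i)\<close> with \<open>2 \<le> i \<le> N\<close> is given by a function \<open>d\<close>; its values outside
  this range are irrelevant.  The conditions that mention letters beyond \<open>N\<close> are void.\<close>

definition greedy_G_expansion :: "nat \<Rightarrow> nat \<Rightarrow> (nat \<Rightarrow> nat) \<Rightarrow> bool" where
  "greedy_G_expansion a N d \<longleftrightarrow>
     (\<forall>i\<in>{2..N}. d i \<in> {0..a - 1}) \<and>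
     (\<forall>i\<in>{5..N}. [d i, d (i - 1), d (i - 2), d (i - 3)] <\<^sub>l\<^sub>e\<^sub>x [a - 1, a - 1, 0, 1]) \<and>
     (3 \<le> N \<longrightarrow> [d 3, d 2] <\<^sub>l\<^sub>e\<^sub>x [a - 1, a - 1]) \<and>
     (4 \<le> N \<longrightarrow> [d 4, d 3, d 2] <\<^sub>l\<^sub>e\<^sub>x [a - 1, a - 1, 0])"

text \<open>The set \<open>\<G>\<^sub>a\<close>; the index of summation is shifted by \<open>2\<close>.\<close>

definition G_set :: "nat \<Rightarrow> complex \<Rightarrow> complex set" where
  "G_set a \<alpha> =
     {z. \<exists>d. (\<forall>N\<ge>2. greedy_G_expansion a N d) \<and>
             (\<lambda>i. of_nat (d (i + 2)) * \<alpha> ^ (i + 2)) sums z}"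

definition lattice_pts :: "complex \<Rightarrow> complex set" where
  "lattice_pts \<alpha> = {of_int m + of_int n * \<alpha> | m n :: int. True}"

definition translate :: "complex set \<Rightarrow> complex \<Rightarrow> complex set" where
  "translate S u = (\<lambda>z. z + u) ` S"

end

theory Submission
  imports Defs
begin

text \<open>
  Write \<open>L = \<int> + \<int>\<alpha>\<close>.  Every power of \<open>\<alpha>\<close> is \<open>G i\<close> times \<open>\<alpha>\<^sup>2\<close> plus an element of \<open>L\<close>
  (\<open>power_mod_lattice\<close>), where \<open>G\<close> satisfies the linear recurrence of \<open>x ^ 3 - a x\<^sup>2 + x - 1\<close>.
  The admissible words are the greedy expansions of the natural numbers in the weights \<open>G i\<close>:
  they exist and are unique.  So each \<open>p + q \<alpha> + n \<alpha>\<^sup>2\<close> with \<open>n \<ge> 0\<close> is a lattice point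
  plus a finite admissible sum, and the lattice point is determined
  (\<open>lattice_translate_unique\<close>).

  Covering.  The points with \<open>n \<ge> 0\<close> are dense in the plane (\<open>finite_points_dense\<close>).  They lie
  in the union of the translates, and this union is closed since the tile is compact
  (\<open>compact_G_set\<close>) and \<open>L\<close> is discrete.

  Disjointness.  Finite admissible sums are dense in each tile, and a finite
  sum lies in no other tile at all, not even on its boundary (\<open>finite_point_exclusive\<close>).  If it did,
  it would equal an infinite admissible sum in another translate.  The suitably scaled differences
  between the partial sums and the point are elements of \<open>\<int>[\<alpha>]\<close> that stay bounded in both
  conjugates, hence they run through a finite set.  By the finiteness property of \<open>\<beta>\<close>, positive
  elements of \<open>\<int>[\<beta>]\<close> have finite expansions in base \<open>\<beta>\<close> (\<open>finite_expansion_pos\<close>), here of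
  uniformly bounded length.  This rewrites a partial sum as the point plus digits at very high
  indices, and uniqueness of finite expansions identifies the two translates.

  The finiteness property is proved for all \<open>a\<close> at once.  In suitable integer coordinates the
  \<open>\<beta>\<close>-transformation is the recursion \<open>z (n + 2) = \<lceil>s z (n + 1) - r z n\<rceil>\<close> with
  \<open>0 < s \<le> 1 / 4\<close> and \<open>s < r \<le> 4 / 7\<close>, whose orbits all reach zero
  (\<open>orbit_reaches_zero\<close>).\<close>

section \<open>Admissible digit sequences\<close>

text \<open>A block \<open>(a - 1)(a - 1)\<close>, read from high to low index, must be followed by two zeros.  This
extends the condition on windows of four letters to the lowest indices as if a nonzero letter
stood at index \<open>1\<close>: there the block is forbidden altogether.  Unlike the lexicographic
conditions, this form does not depend on the length of the word.\<close>

definition admissible :: "nat \<Rightarrow> (nat \<Rightarrow> nat) \<Rightarrow> bool" where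
  "admissible a d \<longleftrightarrow> (\<forall>i\<ge>2. d i \<le> a - 1) \<and>
     (\<forall>i\<ge>3. d i = a - 1 \<and> d (i - 1) = a - 1 \<longrightarrow> 5 \<le> i \<and> d (i - 2) = 0 \<and> d (i - 3) = 0)"

lemma admissible_digit: "admissible a d \<Longrightarrow> 2 \<le> i \<Longrightarrow> d i \<le> a - 1"
  by (simp add: admissible_def)

lemma admissible_window:
  assumes "admissible a d" "3 \<le> i" "d i = a - 1" "d (i - 1) = a - 1"
  shows "5 \<le> i" "d (i - 2) = 0" "d (i - 3) = 0"
  using assms by (auto simp: admissible_def)

lemma admissibleI:
  assumes "\<And>i. 2 \<le> i \<Longrightarrow> d i \<le> a - 1"
    and "\<And>i. 3 \<le> i \<Longrightarrow> d i = a - 1 \<Longrightarrow> d (i - 1) = a - 1 \<Longrightarrow> 5 \<le> i \<and> d (i - 2) = 0 \<and> d (i - 3) = 0"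
  shows "admissible a d"
  using assms by (auto simp: admissible_def)

lemma greedy_all_iff_admissible:
  "(\<forall>N\<ge>2. greedy_G_expansion a N d) \<longleftrightarrow> admissible a d"
proof
  assume g: "\<forall>N\<ge>2. greedy_G_expansion a N d"
  show "admissible a d"
  proof (rule admissibleI)
    fix i :: nat assume "2 \<le> i"
    then show "d i \<le> a - 1" using g unfolding greedy_G_expansion_def by fastforce
  next
    fix i :: nat assume i: "3 \<le> i" and e: "d i = a - 1" "d (i - 1) = a - 1"
    have gi: "greedy_G_expansion a i d" using g i by auto
    have "i \<noteq> 3" using gi e by (auto simp: greedy_G_expansion_def)
    moreover have "i \<noteq> 4" using gi e by (auto simp: greedy_G_expansion_def)
    ultimately have "5 \<le> i" using i by simp
    moreover have "[d i, d (i - 1), d (i - 2), d (i - 3)] <\<^sub>l\<^sub>e\<^sub>x [a - 1, a - 1, 0, 1]"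
      using gi \<open>5 \<le> i\<close> by (auto simp: greedy_G_expansion_def)
    ultimately show "5 \<le> i \<and> d (i - 2) = 0 \<and> d (i - 3) = 0" using e by auto
  qed
next
  assume ad: "admissible a d"
  have dig: "d i \<le> a - 1" if "2 \<le> i" for i using admissible_digit[OF ad that] .
  have win: "5 \<le> i \<and> d (i - 2) = 0 \<and> d (i - 3) = 0"
    if "3 \<le> i" "d i = a - 1" "d (i - 1) = a - 1" for i
    using admissible_window[OF ad that] by auto
  show "\<forall>N\<ge>2. greedy_G_expansion a N d"
  proof (intro allI impI)
    fix N :: nat
    show "greedy_G_expansion a N d"
      unfolding greedy_G_expansion_def
    proof (intro conjI ballI impI)
      fix i assume "i \<in> {2..N}" then show "d i \<in> {0..a - 1}" using dig by auto
    next
      fix i assume "i \<in> {5..N}"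
      then show "[d i, d (i - 1), d (i - 2), d (i - 3)] <\<^sub>l\<^sub>e\<^sub>x [a - 1, a - 1, 0, 1]"
        using dig[of i] dig[of "i - 1"] win[of i] by auto
    next
      show "[d 3, d 2] <\<^sub>l\<^sub>e\<^sub>x [a - 1, a - 1]" using dig[of 3] dig[of 2] win[of 3] by (cases "d 2 = a - 1"; cases "d 3 = a - 1") auto
    next
      show "[d 4, d 3, d 2] <\<^sub>l\<^sub>e\<^sub>x [a - 1, a - 1, 0]" using dig[of 4] dig[of 3] win[of 4] by (cases "d 3 = a - 1"; cases "d 4 = a - 1") auto
    qed
  qed
qed

lemma admissible_truncate:
  assumes "2 \<le> a" "admissible a d"
  shows "admissible a (\<lambda>i. if i \<le> N then d i else 0)"
proof (rule admissibleI)
  fix i :: nat assume i: "3 \<le> i"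
    and e: "(if i \<le> N then d i else 0) = a - 1" "(if i - 1 \<le> N then d (i - 1) else 0) = a - 1"
  have "i \<le> N" using e(1) assms(1) by (auto split: if_splits)
  then have "i - 1 \<le> N" by simp
  with \<open>i \<le> N\<close> show "5 \<le> i \<and> (if i - 2 \<le> N then d (i - 2) else 0) = 0 \<and> (if i - 3 \<le> N then d (i - 3) else 0) = 0"
    using e i admissible_window[OF assms(2) i] by auto
qed (use admissible_digit[OF assms(2)] in auto)

text \<open>A gap of zeros makes low and high digits independent, because a block \<open>(a - 1)(a - 1)\<close> cannot
straddle the gap and the two zeros that it demands are found inside it.\<close>

lemma admissible_concat:
  assumes a: "2 \<le> a" and d: "admissible a d" and f: "admissible a f"
    and gap: "\<And>i. i \<le> N + 4 \<Longrightarrow> f i = 0"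
  shows "admissible a (\<lambda>i. if i \<le> N then d i else f i)"
proof (rule admissibleI)
  fix i :: nat assume i: "3 \<le> i"
    and e: "(if i \<le> N then d i else f i) = a - 1" "(if i - 1 \<le> N then d (i - 1) else f (i - 1)) = a - 1"
  have "i \<le> N \<or> N + 5 < i"
  proof (rule ccontr)
    assume "\<not> ?thesis"
    then have "N < i" "i - 1 \<le> N + 4" by auto
    then show False using e gap[of i] gap[of "i - 1"] a
      by (cases "i \<le> N + 4"; cases "i - 1 \<le> N") auto
  qed
  then show "5 \<le> i \<and> (if i - 2 \<le> N then d (i - 2) else f (i - 2)) = 0 \<and>
      (if i - 3 \<le> N then d (i - 3) else f (i - 3)) = 0"
  proof
    assume "i \<le> N"
    then have "i - 1 \<le> N" "i - 2 \<le> N" "i - 3 \<le> N" by auto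
    then show ?thesis using e \<open>i \<le> N\<close> admissible_window[OF d i] by simp
  next
    assume "N + 5 < i"
    then have "\<not> i \<le> N" "\<not> i - 1 \<le> N" "\<not> i - 2 \<le> N" "\<not> i - 3 \<le> N" by auto
    then show ?thesis using e admissible_window[OF f i] by simp
  qed
qed (use admissible_digit[OF d] admissible_digit[OF f] in auto)

section \<open>Greedy expansions of the natural numbers\<close>

text \<open>\<open>gseq a i\<close> is the coefficient of \<open>\<alpha>\<^sup>2\<close> in \<open>\<alpha> ^ i\<close> with respect to the basis \<open>1, \<alpha>, \<alpha>\<^sup>2\<close>;
the recurrence is that of the powers of a root of \<open>x ^ 3 - a x\<^sup>2 + x - 1\<close>.\<close>

fun gseq :: "nat \<Rightarrow> nat \<Rightarrow> int" where
  "gseq a 0 = 0"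
| "gseq a (Suc 0) = 0"
| "gseq a (Suc (Suc 0)) = 1"
| "gseq a (Suc (Suc (Suc n))) = int a * gseq a (Suc (Suc n)) - gseq a (Suc n) + gseq a n"

locale numeration =
  fixes a :: nat
  assumes a2: "2 \<le> a"
begin

abbreviation G :: "nat \<Rightarrow> int" where "G \<equiv> gseq a"

lemma G_2: "G 2 = 1" by (simp add: numeral_2_eq_2)
lemma G_3: "G 3 = int a" by (simp add: numeral_3_eq_3)
lemma G_rec: "G (n + 3) = int a * G (n + 2) - G (n + 1) + G n"
  by (simp add: numeral_3_eq_3)

lemma G_step: "0 \<le> G n \<and> G (n + 1) + 1 \<le> G (n + 2)"
proof (induction n rule: less_induct)
  case (less n)
  show ?case
  proof (cases "n < 2")
    case True
    then have "n = 0 \<or> n = 1" by auto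
    then show ?thesis using a2 G_2 G_3 by (auto simp: numeral_3_eq_3 numeral_2_eq_2)
  next
    case False
    then obtain m where m: "n = m + 2" by (metis add.commute le_add_diff_inverse not_less)
    have 0: "0 \<le> G m" "G (m + 1) + 1 \<le> G (m + 2)" and 1: "0 \<le> G (m + 1)" "G (m + 2) + 1 \<le> G (m + 3)"
      using less[of m] less[of "m + 1"] m by (auto simp: numeral_3_eq_3)
    have "0 \<le> G (m + 3)" using 0 1 by simp
    then have "2 * G (m + 3) \<le> int a * G (m + 3)" using a2 by (intro mult_right_mono) auto
    then have "G (m + 3) + 1 \<le> G (m + 4)" using 0 1 G_rec[of "m + 1"] by (simp add: numeral_eq_Suc)
    then show ?thesis using 0 1 m by (simp add: numeral_eq_Suc)
  qed
qed

lemma G_nonneg: "0 \<le> G n"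
  using G_step[of n] by simp

lemma G_less: "1 \<le> n \<Longrightarrow> G n < G (n + 1)"
  using G_step[of "n - 1"] by simp

lemma G_pos: "2 \<le> n \<Longrightarrow> 0 < G n"
  using G_less[of "n - 1"] G_nonneg[of "n - 1"] by (cases n) auto

lemma G_unbounded: "int n \<le> G (n + 1)"
proof (induction n)
  case (Suc n) then show ?case using G_step[of n] by simp
qed (simp add: numeral_2_eq_2)

lemma G_le_mult: "2 \<le> n \<Longrightarrow> G (n + 1) \<le> int a * G n"
proof -
  assume n: "2 \<le> n"
  then obtain m where m: "n = m + 2" by (metis add.commute le_add_diff_inverse)
  show ?thesis using G_rec[of m] G_step[of m] G_less[of m] m
    by (cases "m = 0") (auto simp: numeral_3_eq_3)
qed

text \<open>Multiplying \<open>x ^ 3 - a x\<^sup>2 + x - 1\<close> by \<open>x + 1\<close> gives \<open>x ^ 4 - (a - 1) x ^ 3 - (a - 1) x\<^sup>2 - 1\<close>,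
so the sequence also obeys the recurrence read off from the word \<open>(a - 1)(a - 1)01\<close>.  This is where
the forbidden words come from.\<close>

lemma G_parry: "3 \<le> N \<Longrightarrow> G (N + 1) = (int a - 1) * (G N + G (N - 1)) + G (N - 3)"
proof -
  assume N: "3 \<le> N"
  then obtain m where m: "N = m + 3" by (metis add.commute le_add_diff_inverse)
  show ?thesis using G_rec[of m] G_rec[of "m + 1"] m
    by (simp add: numeral_eq_Suc algebra_simps)
qed

definition G_sum :: "(nat \<Rightarrow> nat) \<Rightarrow> nat \<Rightarrow> int" where
  "G_sum d N = (\<Sum>i=2..N. int (d i) * G i)"

lemma G_sum_1: "N < 2 \<Longrightarrow> G_sum d N = 0" by (simp add: G_sum_def)

lemma G_sum_Suc: "2 \<le> Suc N \<Longrightarrow> G_sum d (Suc N) = G_sum d N + int (d (Suc N)) * G (Suc N)"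
  unfolding G_sum_def by (subst sum.cl_ivl_Suc) auto

lemma G_sum_last: "2 \<le> N \<Longrightarrow> G_sum d N = G_sum d (N - 1) + int (d N) * G N"
  using G_sum_Suc[of "N - 1" d] by simp

lemma G_sum_nonneg: "0 \<le> G_sum d N"
  unfolding G_sum_def by (intro sum_nonneg mult_nonneg_nonneg G_nonneg) auto

text \<open>A leading digit below \<open>a - 1\<close> leaves room for everything below it, and so does a digit below
\<open>a - 1\<close> after one leading \<open>a - 1\<close>.  After two leading digits \<open>a - 1\<close> the two zeros
push the rest below \<open>G (N - 3)\<close>, which is the room that \<open>G_parry\<close> leaves.\<close>

lemma G_sum_less:
  assumes "admissible a d" "1 \<le> N"
  shows "G_sum d N < G (N + 1)"
  using assms(2)
proof (induction N rule: less_induct)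
  case (less N)
  have G0: "0 \<le> G k" for k by (rule G_nonneg)
  consider "N = 1" | "N = 2" | "3 \<le> N" using less.prems by linarith
  then show ?case
  proof cases
    case 1 then show ?thesis using G_2 by (simp add: G_sum_1 numeral_2_eq_2)
  next
    case 2
    have "int (d 2) \<le> int a - 1" using admissible_digit[OF assms(1), of 2] a2 by linarith
    then show ?thesis using 2 G_2 G_3 by (simp add: G_sum_last G_sum_1)
  next
    case 3
    have IH1: "G_sum d (N - 1) < G N" using less.IH[of "N - 1"] 3 by simp
    have IH2: "G_sum d (N - 2) < G (N - 1)" using less.IH[of "N - 2"] 3
      by (simp add: Suc_diff_le[symmetric])
    have s1: "G_sum d N = G_sum d (N - 1) + int (d N) * G N" using 3 by (simp add: G_sum_last)
    have s2: "G_sum d (N - 1) = G_sum d (N - 2) + int (d (N - 1)) * G (N - 1)"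
      using 3 G_sum_last[of "N - 1" d] by (simp add: numeral_2_eq_2)
    have d1: "int (d N) \<le> int a - 1" "int (d (N - 1)) \<le> int a - 1"
      using admissible_digit[OF assms(1), of N] admissible_digit[OF assms(1), of "N - 1"] a2 3 by linarith+
    note P = G_parry[OF 3]
    consider "int (d N) \<le> int a - 2" | "d N = a - 1" "int (d (N - 1)) \<le> int a - 2"
      | "d N = a - 1" "d (N - 1) = a - 1" using d1 by linarith
    then show ?thesis
    proof cases
      case 1
      have "int (d N) * G N \<le> (int a - 2) * G N" by (intro mult_right_mono 1 G0)
      moreover have "0 \<le> (int a - 1) * G (N - 1)" using a2 by (intro mult_nonneg_nonneg G0) auto
      ultimately show ?thesis using s1 IH1 P G0[of "N - 3"] by (simp add: algebra_simps)
    next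
      case 2
      have "int (d (N - 1)) * G (N - 1) \<le> (int a - 2) * G (N - 1)" by (intro mult_right_mono 2 G0)
      moreover have "int (d N) * G N = (int a - 1) * G N" using 2 a2 by (simp add: of_nat_diff)
      ultimately show ?thesis using s1 s2 IH2 P G0[of "N - 3"] by (simp add: algebra_simps)
    next
      case 3
      note w = admissible_window[OF assms(1) \<open>3 \<le> N\<close> 3]
      have e: "int (d N) = int a - 1" "int (d (N - 1)) = int a - 1" using 3 a2 by auto
      have "G_sum d (N - 2) = G_sum d (N - 3) + int (d (N - 2)) * G (N - 2)"
        using w(1) G_sum_last[of "N - 2" d] by (simp add: numeral_eq_Suc)
      moreover have "G_sum d (N - 3) = G_sum d (N - 4) + int (d (N - 3)) * G (N - 3)"
        using w(1) G_sum_last[of "N - 3" d] by (simp add: numeral_eq_Suc)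
      moreover have "N - 4 + 1 = N - 3" using w(1) by simp
      then have "G_sum d (N - 4) < G (N - 3)" using less.IH[of "N - 4"] w(1) by simp
      ultimately show ?thesis using s1[unfolded e] s2[unfolded e] P w by (simp add: algebra_simps)
    qed
  qed
qed

text \<open>By \<open>G_sum_less\<close> the top digit is the quotient of the sum by the top weight.\<close>

lemma greedy_expansion_unique:
  assumes "admissible a d" "admissible a e" "G_sum d N = G_sum e N" "2 \<le> i" "i \<le> N"
  shows "d i = e i"
  using assms(3-5)
proof (induction N)
  case (Suc N)
  have *: "G_sum d N + int (d (Suc N)) * G (Suc N) = G_sum e N + int (e (Suc N)) * G (Suc N)"
    using Suc.prems G_sum_Suc[of N] by simp
  have b: "0 \<le> G_sum d N" "0 \<le> G_sum e N" "G_sum d N < G (Suc N)" "G_sum e N < G (Suc N)"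
    using G_sum_nonneg G_sum_less[OF assms(1), of N] G_sum_less[OF assms(2), of N] Suc.prems by auto
  have "(G_sum d N + int (d (Suc N)) * G (Suc N)) div G (Suc N) = int (d (Suc N))"
       "(G_sum e N + int (e (Suc N)) * G (Suc N)) div G (Suc N) = int (e (Suc N))"
    using b by auto
  then have eq: "d (Suc N) = e (Suc N)" using * by simp
  then have "G_sum d N = G_sum e N" using * by simp
  then show ?case using Suc eq by (cases "i = Suc N") auto
qed simp

text \<open>Division with remainder by the weights, from the top, yields the digits.  A violation of the
window condition would make the number at least \<open>G (N + 1)\<close> by \<open>G_parry\<close>.\<close>

lemma greedy_expansion_exists_below:
  assumes "0 \<le> n" "n < G (N + 1)" "1 \<le> N"
  shows "\<exists>d. admissible a d \<and> (\<forall>i>N. d i = 0) \<and> G_sum d N = n"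
  using assms
proof (induction N arbitrary: n)
  case (Suc N)
  show ?case
  proof (cases "N = 0")
    case True
    then have "n = 0" using Suc.prems by (simp add: numeral_2_eq_2)
    then show ?thesis using a2 True
      by (intro exI[of _ "\<lambda>_. 0"]) (auto simp: admissible_def G_sum_def)
  next
    case False
    define g where "g = G (Suc N)"
    have g: "0 < g" using False G_pos[of "Suc N"] by (simp add: g_def)
    define q where "q = nat (n div g)"
    have q0: "0 \<le> n div g" using Suc.prems g by (simp add: pos_imp_zdiv_nonneg_iff)
    have q: "int q = n div g" using q0 by (simp add: q_def)
    have "0 \<le> n mod g" "n mod g < g" using g by auto
    then obtain d where d: "admissible a d" "\<forall>i>N. d i = 0" "G_sum d N = n mod g"
      using Suc.IH[of "n mod g"] False by (auto simp: g_def)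
    define e where "e = d(Suc N := q)"
    have "G_sum e N = G_sum d N" unfolding G_sum_def e_def by (intro sum.cong) auto
    then have es: "G_sum e (Suc N) = n" using G_sum_Suc[of N e] False d(3) q
      by (simp add: e_def g_def[symmetric] mult.commute)
    have "n < int a * g" using Suc.prems G_le_mult[of "Suc N"] False by (simp add: g_def)
    then have "n div g < int a" 
    proof -
      have "\<not> int a * g \<le> n div g * g" using \<open>n < int a * g\<close> div_mult_mod_eq[of n g] g
        by (smt (verit) pos_mod_sign)
      then show ?thesis using g by (meson mult_right_mono not_less order_less_imp_le)
    qed
    then have qa: "q \<le> a - 1" using q a2 by linarith
    have "admissible a e"
    proof (rule admissibleI)
      fix i :: nat assume "2 \<le> i" then show "e i \<le> a - 1"
        using qa admissible_digit[OF d(1)] by (auto simp: e_def)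
    next
      fix i :: nat assume i: "3 \<le> i" "e i = a - 1" "e (i - 1) = a - 1"
      have "e i \<noteq> 0" using i a2 by simp
      then have "i \<le> Suc N" using d(2) by (cases "i \<le> Suc N") (auto simp: e_def)
      show "5 \<le> i \<and> e (i - 2) = 0 \<and> e (i - 3) = 0"
      proof (cases "i = Suc N")
        case False
        then have "i \<le> N" using \<open>i \<le> Suc N\<close> by simp
        then have "i - 1 \<le> N" "i - 2 \<le> N" "i - 3 \<le> N" by auto
        then have "e (i - k) = d (i - k)" if "k \<le> 3" for k
          using that \<open>i \<le> N\<close> by (auto simp: e_def)
        from this[of 0] this[of 1] this[of 2] this[of 3] show ?thesis
          using admissible_window[OF d(1) i(1)] i by simp
      next
        case True
        define S where "S = G_sum e (i - 2)"
        have e_top: "int (e (i - 1)) = int a - 1" "int (e i) = int a - 1" using i a2 by auto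
        have "G_sum e i = S + int (e (i - 1)) * G (i - 1) + int (e i) * G i"
          using i(1) G_sum_last[of i e] G_sum_last[of "i - 1" e] by (simp add: S_def numeral_2_eq_2)
        then have "n = S + (int a - 1) * (G i + G (i - 1))"
          using es True unfolding e_top by (simp add: algebra_simps)
        moreover have "n < (int a - 1) * (G i + G (i - 1)) + G (i - 3)"
          using Suc.prems True G_parry[OF i(1)] by simp
        \<comment> \<open>The low part is smaller than the weights of the next two digits, so these digits vanish; for
          \<open>i = 3\<close> and \<open>i = 4\<close> the bound is \<open>G 0 = G 1 = 0\<close>, so the block cannot occur at all.\<close>
        ultimately have S: "S < G (i - 3)" by linarith
        have S0: "0 \<le> S" by (simp add: S_def G_sum_nonneg)
        have "G 0 = 0" "G 1 = 0" by auto
        then have "i - 3 \<noteq> 0" "i - 3 \<noteq> 1" using S S0 by (metis not_less)+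
        then have i5: "5 \<le> i" by linarith
        have T: "S = G_sum e (i - 4) + int (e (i - 3)) * G (i - 3) + int (e (i - 2)) * G (i - 2)"
          using i5 G_sum_last[of "i - 2" e] G_sum_last[of "i - 3" e]
          by (simp add: S_def numeral_eq_Suc)
        have z: "k = 0" if "int k * x < y" "0 \<le> y" "y \<le> x" for k and x y :: int
        proof (rule ccontr)
          assume "k \<noteq> 0"
          then have "1 * x \<le> int k * x" using that by (intro mult_right_mono) auto
          then show False using that by simp
        qed
        have nn: "0 \<le> G_sum e (i - 4)" "0 \<le> int (e (i - 3)) * G (i - 3)" "0 \<le> int (e (i - 2)) * G (i - 2)"
          by (auto intro: G_sum_nonneg mult_nonneg_nonneg G_nonneg)
        have "i - 3 + 1 = i - 2" "1 \<le> i - 3" using i5 by simp_all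
        then have "G (i - 3) \<le> G (i - 2)" using G_less[of "i - 3"] by simp
        then have "e (i - 2) = 0" using T S nn by (intro z[of _ "G (i - 2)" "G (i - 3)"] G_nonneg) linarith+
        moreover have "e (i - 3) = 0" using T S nn by (intro z[of _ "G (i - 3)" "G (i - 3)"] G_nonneg) linarith+
        ultimately show ?thesis using i5 by simp
      qed
    qed
    moreover have "\<forall>i>Suc N. e i = 0" using d(2) by (simp add: e_def)
    ultimately show ?thesis using es by blast
  qed
qed simp

lemma greedy_expansion_exists:
  assumes "0 \<le> n"
  shows "\<exists>d N. admissible a d \<and> (\<forall>i>N. d i = 0) \<and> G_sum d N = n"
proof -
  have "n < G (nat n + 1 + 1)" using G_unbounded[of "nat n + 1"] assms by simp
  then show ?thesis using greedy_expansion_exists_below[of n "nat n + 1"] assms by auto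
qed

end

section \<open>A shift radix system with finite orbits\<close>

text \<open>With \<open>r = 1 / \<beta>\<close> and \<open>s = a - \<beta> = r - r\<^sup>2\<close> this recursion is the \<open>\<beta>\<close>-transformation on
\<open>\<int>[\<beta>] \<inter> [0, 1)\<close>, written in integer coordinates: the fractional part of \<open>r x - s y\<close>, for
integers \<open>x\<close> and \<open>y\<close>, is mapped to that of \<open>r y - s \<lceil>s y - r x\<rceil>\<close>.  An element
has a finite \<open>\<beta>\<close>-expansion as soon as its orbit reaches \<open>(0, 0)\<close>.\<close>

locale contracting_srs =
  fixes s r :: real and z :: "nat \<Rightarrow> int"
  assumes s: "0 < s" "s \<le> 1 / 4" "s < r" and r: "r \<le> 4 / 7"
    and step: "z (n + 2) = \<lceil>s * z (n + 1) - r * z n\<rceil>"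
begin

lemma step_bounds:
  "s * z (n + 1) - r * z n \<le> z (n + 2)" "z (n + 2) < s * z (n + 1) - r * z n + 1"
  unfolding step by linarith+

lemma lower_bound:
  assumes "z n \<le> P" "- m \<le> z (n + 1)" "0 \<le> P" "0 \<le> m"
  shows "- (real_of_int m / 4 + 4 / 7 * P) \<le> z (n + 2)"
proof -
  have "r * z n \<le> r * P" using assms s by (intro mult_left_mono) auto
  moreover have "r * P \<le> 4 / 7 * P" using assms r by (intro mult_right_mono) auto
  moreover have "s * (- m) \<le> s * z (n + 1)" using assms s by (intro mult_left_mono) auto
  moreover have "s * m \<le> 1 / 4 * m" using assms s by (intro mult_right_mono) auto
  ultimately show ?thesis using step_bounds(1)[of n] by simp
qed

lemma upper_bound:
  assumes "- m \<le> z n" "z (n + 1) \<le> P" "0 \<le> P" "0 \<le> m"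
  shows "z (n + 2) < real_of_int P / 4 + 4 / 7 * m + 1"
proof -
  have "r * (- m) \<le> r * z n" using assms s by (intro mult_left_mono) auto
  moreover have "r * m \<le> 4 / 7 * m" using assms r by (intro mult_right_mono) auto
  moreover have "s * z (n + 1) \<le> s * P" using assms s by (intro mult_left_mono) auto
  moreover have "s * P \<le> 1 / 4 * P" using assms s by (intro mult_right_mono) auto
  ultimately show ?thesis using step_bounds(2)[of n] by simp
qed

text \<open>Lower and upper bounds are kept apart because rounding up only enlarges values: the lower bound
shrinks at once, and the shrunken lower bound then improves the upper one.\<close>

definition stays :: "int \<Rightarrow> int \<Rightarrow> nat \<Rightarrow> bool" where
  "stays m P n \<longleftrightarrow> (\<forall>k\<ge>n. - m \<le> z k \<and> z k \<le> P)"

lemma stays_stable: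
  assumes "- m \<le> z n" "z n \<le> P" "- m \<le> z (n + 1)" "z (n + 1) \<le> P" "0 \<le> m" "0 \<le> P"
    and "real_of_int m / 4 + 4 / 7 * P < m + 1" "real_of_int P / 4 + 4 / 7 * m \<le> P"
  shows "stays m P n"
proof -
  have "(- m \<le> z (n + k) \<and> z (n + k) \<le> P) \<and> (- m \<le> z (n + k + 1) \<and> z (n + k + 1) \<le> P)" for k
  proof (induction k)
    case (Suc k)
    have "- real_of_int (m + 1) < z (n + k + 2)" using lower_bound[of "n + k" P m] Suc assms by simp
    moreover have "z (n + k + 2) < real_of_int (P + 1)" using upper_bound[of m "n + k" P] Suc assms by simp
    ultimately show ?case using Suc by (simp add: of_int_minus[symmetric] del: of_int_minus of_int_add)
  qed (use assms in auto)
  then show ?thesis unfolding stays_def by (metis le_add_diff_inverse)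
qed

lemma stays_ball: "\<bar>z n\<bar> \<le> M \<Longrightarrow> \<bar>z (n + 1)\<bar> \<le> M \<Longrightarrow> stays M M n"
  by (rule stays_stable) auto

lemma stays_raise_lower:
  assumes "stays m P n" "0 \<le> m" "0 \<le> P" "real_of_int m / 4 + 4 / 7 * P < m' + 1"
  shows "stays m' P (n + 2)"
  unfolding stays_def
proof (intro allI impI conjI)
  fix k assume k: "n + 2 \<le> k"
  then obtain j where j: "k = j + 2" "n \<le> j" by (metis add_le_cancel_right le_add_diff_inverse2 le_trans le_add2)
  have "z j \<le> P" "- m \<le> z (j + 1)" using assms(1) j by (auto simp: stays_def)
  then have "- real_of_int (m' + 1) < z k" using lower_bound[of j P m] assms j by simp
  then show "- m' \<le> z k" by (simp add: of_int_minus[symmetric] del: of_int_minus of_int_add)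
  show "z k \<le> P" using assms(1) k by (auto simp: stays_def)
qed

lemma stays_drop_upper:
  assumes "stays m P n" "0 \<le> m" "0 \<le> P" "real_of_int P / 4 + 4 / 7 * m \<le> P'"
  shows "stays m P' (n + 2)"
  unfolding stays_def
proof (intro allI impI conjI)
  fix k assume k: "n + 2 \<le> k"
  then obtain j where j: "k = j + 2" "n \<le> j" by (metis add_le_cancel_right le_add_diff_inverse2 le_trans le_add2)
  have "- m \<le> z j" "z (j + 1) \<le> P" using assms(1) j by (auto simp: stays_def)
  then have "z k < real_of_int (P' + 1)" using upper_bound[of m j P] assms j by simp
  then show "z k \<le> P'" by (simp del: of_int_add)
  show "- m \<le> z k" using assms(1) k by (auto simp: stays_def)
qed

text \<open>For \<open>M \<ge> 3\<close> the bound \<open>M\<close> improves to \<open>M - 1\<close>, first from below by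
\<open>(1 / 4 + 4 / 7) M < M\<close>, then from above by
\<open>M / 4 + 4 / 7 (M - 1) \<le> M - 1\<close>, which holds for \<open>M \<ge> 12 / 5\<close>.\<close>

lemma eventually_small: "\<exists>n. stays 2 2 n"
proof -
  have "\<exists>n. stays 2 2 n" if "stays (int M) (int M) n" for M n
    using that
  proof (induction M arbitrary: n)
    case (Suc M)
    show ?case
    proof (cases "Suc M \<le> 2")
      case True
      then have "int (Suc M) \<le> 2" by simp
      then show ?thesis using Suc.prems unfolding stays_def by (smt (verit))
    next
      case False
      then have "2 \<le> real M" by simp
      then have "stays (int M) (int (Suc M)) (n + 2)"
        by (intro stays_raise_lower[OF Suc.prems]) (auto simp: field_simps)
      from stays_drop_upper[OF this, of "int M"]
      have "stays (int M) (int M) (n + 2 + 2)" using \<open>2 \<le> real M\<close> by (simp add: field_simps)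
      then show ?thesis by (rule Suc.IH)
    qed
  next
    case 0
    then show ?case unfolding stays_def by (intro exI[of _ n]) force
  qed
  moreover have "stays (int (nat (max \<bar>z 0\<bar> \<bar>z 1\<bar>))) (int (nat (max \<bar>z 0\<bar> \<bar>z 1\<bar>))) 0"
    by (rule stays_ball) auto
  ultimately show ?thesis by blast
qed

text \<open>From the bound \<open>2\<close> on, the general estimate gets stuck at values in \<open>{-1, \<dots>, 2}\<close>.  A value
\<open>2\<close> can then only follow \<open>-1, 2\<close>, and this pattern cannot perpetuate itself.  Two values
in \<open>{-1, 0, 1}\<close> are followed by a nonnegative one.  Once all values are \<open>0\<close> or \<open>1\<close>, every
\<open>1\<close> has a \<open>0\<close> two steps later, so at most two ones precede \<open>0, 0\<close>.\<close>

lemma orbit_reaches_zero: "\<exists>n. z n = 0 \<and> z (n + 1) = 0"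
proof -
  obtain n0 where "stays 2 2 n0" using eventually_small by blast
  then have "stays 1 2 (n0 + 2)" by (rule stays_raise_lower) auto
  then obtain n where w: "stays 1 2 n" by blast
  have two: "z k = -1 \<and> z (k + 1) = 2" if "z (k + 2) = 2" "n \<le> k" for k
  proof -
    have k: "-1 \<le> z k" "z k \<le> 2" "-1 \<le> z (k + 1)" "z (k + 1) \<le> 2"
      using w that by (auto simp: stays_def)
    have "1 < s * z (k + 1) - r * z k" using step_bounds(2)[of k] that by simp
    moreover have "z k = -1 \<or> z k = 0 \<or> z k = 1 \<or> z k = 2"
       "z (k + 1) = -1 \<or> z (k + 1) = 0 \<or> z (k + 1) = 1 \<or> z (k + 1) = 2" using k by linarith+
    ultimately show ?thesis using s r by (auto; linarith)
  qed
  have "z (k + 4) \<noteq> 2" if "n \<le> k" for k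
    using two[of "k + 2"] two[of "k + 1"] that by (auto simp: numeral_eq_Suc)
  then have "stays 1 1 (n + 4)"
    using w unfolding stays_def
    by (smt (verit) add.commute add_leD2 le_add_diff_inverse nat_le_iff_add add_le_cancel_left trans_le_add1 group_cancel.add1)
  then have w1: "-1 \<le> z k" "z k \<le> 1" if "n + 4 \<le> k" for k using that by (auto simp: stays_def)
  have nonneg: "z (k + 2) = 0 \<or> z (k + 2) = 1" if "n + 4 \<le> k" for k
  proof -
    have k: "z k = -1 \<or> z k = 0 \<or> z k = 1" "z (k + 1) = -1 \<or> z (k + 1) = 0 \<or> z (k + 1) = 1"
      using w1[of k] w1[of "k + 1"] that by linarith+
    then have "-1 < s * z (k + 1) - r * z k" using s r by (auto; linarith)
    then have "real_of_int (-1) < real_of_int (z (k + 2))" using step_bounds(1)[of k] by simp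
    then show ?thesis using w1[of "k + 2"] that by linarith
  qed
  have after1: "z (k + 2) = 0" if "n + 6 \<le> k" "z k = 1" for k
  proof -
    have "z (k + 1) = 0 \<or> z (k + 1) = 1" using nonneg[of "k - 1"] that by (simp add: numeral_eq_Suc)
    then have "s * z (k + 1) - r * z k \<le> 0" using s that by auto
    then show ?thesis using step_bounds(2)[of k] nonneg[of k] that by auto
  qed
  have after00: "z (k + 2) = 0" if "z k = 0" "z (k + 1) = 0" for k using step[of k] that by simp
  define k where "k = n + 6"
  have v: "z (k + j) = 0 \<or> z (k + j) = 1" for j
    using nonneg[of "n + 4 + j"] by (simp add: k_def numeral_eq_Suc)
  have a: "z (k + j) = 1 \<Longrightarrow> z (k + j + 2) = 0" for j using after1[of "k + j"] by (simp add: k_def)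
  show ?thesis
  proof (cases "\<exists>j. z (k + j) = 1")
    case False
    then have "z (k + 0) = 0" "z (k + 1) = 0" using v by blast+
    then show ?thesis by auto
  next
    case True
    then obtain j where j: "z (k + j) = 1" by blast
    have 2: "z (k + j + 2) = 0" using a j by blast
    have v1: "z (k + j + 1) = 0 \<or> z (k + j + 1) = 1" using v[of "j + 1"] by (simp add: add.assoc)
    show ?thesis
    proof (cases "z (k + j + 1) = 0")
      case True then show ?thesis using 2 by (intro exI[of _ "k + j + 1"]) (simp add: numeral_2_eq_2)
    next
      case False
      then have "z (k + j + 3) = 0" using a[of "j + 1"] v1 by (simp add: numeral_eq_Suc)
      then show ?thesis using 2 by (intro exI[of _ "k + j + 2"]) (simp add: numeral_eq_Suc)
    qed
  qed
qed

end

section \<open>The cubic unit and its conjugates\<close>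

locale cubic = numeration a for a :: nat +
  fixes \<beta> :: real and \<alpha> :: complex
  assumes beta_gt: "1 < \<beta>"
    and beta_root: "\<beta> ^ 3 = real a * \<beta> ^ 2 - \<beta> + 1"
    and alpha_root: "\<alpha> ^ 3 = of_nat a * \<alpha> ^ 2 - \<alpha> + 1"
    and alpha_nonreal: "\<alpha> \<notin> \<real>"
    and norm_alpha: "norm \<alpha> < 1"
    and norm_product: "\<beta> * (norm \<alpha>)\<^sup>2 = 1"
begin

lemma alpha_nonzero: "\<alpha> \<noteq> 0" and Im_alpha: "Im \<alpha> \<noteq> 0"
  using alpha_nonreal by (auto simp: complex_is_Real_iff)

lemma beta_less: "\<beta> < a"
proof -
  have "\<beta> ^ 2 * (\<beta> - a) = 1 - \<beta>" using beta_root by (simp add: algebra_simps power2_eq_square power3_eq_cube)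
  then have "\<beta> ^ 2 * (\<beta> - a) < 0" using beta_gt by simp
  then show ?thesis using beta_gt by (simp add: mult_less_0_iff)
qed

text \<open>The equation reads \<open>\<beta> (\<beta> - 1)\<^sup>2 = 1 + (a - 2) \<beta>\<^sup>2 \<ge> 1\<close>.  The bound is sharp enough to
treat all \<open>a\<close> together: it gives \<open>1 / \<beta> \<le> 4 / 7\<close>.\<close>

lemma beta_ge: "7 / 4 \<le> \<beta>"
proof (rule ccontr)
  assume "\<not> ?thesis"
  then have b: "\<beta> < 7 / 4" by simp
  have "\<beta> * (\<beta> - 1)\<^sup>2 = 1 + (real a - 2) * \<beta>\<^sup>2"
    using beta_root by (simp add: algebra_simps power2_eq_square power3_eq_cube)
  moreover have "0 \<le> (real a - 2) * \<beta>\<^sup>2" using a2 by simp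
  moreover have "(\<beta> - 1)\<^sup>2 \<le> (3 / 4)\<^sup>2" using b beta_gt by (intro power_mono) auto
  then have "\<beta> * (\<beta> - 1)\<^sup>2 \<le> 7 / 4 * (3 / 4)\<^sup>2" using b beta_gt by (intro mult_mono) auto
  ultimately show False by (simp add: power2_eq_square)
qed

text \<open>An integer root of a monic integer polynomial with constant term \<open>-1\<close> divides \<open>1\<close>.\<close>

lemma beta_not_int: "\<beta> \<notin> \<int>"
proof
  assume "\<beta> \<in> \<int>"
  then obtain k where k: "\<beta> = of_int k" by (auto elim: Ints_cases)
  have "\<beta> * (\<beta> ^ 2 - a * \<beta> + 1) = 1" using beta_root by (simp add: algebra_simps power2_eq_square power3_eq_cube)
  then have "real_of_int (k * (k ^ 2 - int a * k + 1)) = real_of_int 1" by (simp add: k)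
  then have "k * (k ^ 2 - int a * k + 1) = 1" by (simp only: of_int_eq_iff)
  then have "k dvd 1" by (metis dvd_triv_left)
  then show False using beta_gt k by auto
qed

lemma beta_irrational: "\<beta> \<notin> \<rat>"
proof
  assume "\<beta> \<in> \<rat>"
  moreover have "algebraic_int \<beta>"
  proof (rule algebraic_int.intros)
    show "poly [:- 1, 1, - of_nat a, 1:] \<beta> = 0" using beta_root
      by (simp add: algebra_simps power2_eq_square power3_eq_cube)
    show "lead_coeff [:- 1, 1, - of_nat a, 1 :: real:] = 1" by simp
    show "\<forall>i. coeff [:- 1, 1, - of_nat a, 1 :: real:] i \<in> \<int>"
      by (auto simp: coeff_pCons split: nat.split)
  qed
  ultimately show False using rational_algebraic_int_is_int beta_not_int by blast
qed

text \<open>A quadratic equation for \<open>\<alpha>\<close> has \<open>p / n\<close> as product of its roots \<open>\<alpha>\<close> and \<open>cnj \<alpha>\<close>;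
since \<open>\<beta> (norm \<alpha>)\<^sup>2 = 1\<close> this would make \<open>\<beta>\<close> rational.\<close>

lemma alpha_independent:
  fixes p q n :: int
  assumes "of_int p + of_int q * \<alpha> + of_int n * \<alpha>\<^sup>2 = 0"
  shows "p = 0 \<and> q = 0 \<and> n = 0"
proof -
  have im: "(of_int q + 2 * of_int n * Re \<alpha>) * Im \<alpha> = 0"
    and re: "of_int p + of_int q * Re \<alpha> + of_int n * ((Re \<alpha>)\<^sup>2 - (Im \<alpha>)\<^sup>2) = 0"
    using assms by (auto simp: complex_eq_iff power2_eq_square algebra_simps)
  then have q: "of_int q = - 2 * of_int n * Re \<alpha>" using Im_alpha by simp
  then have "real_of_int p = of_int n * ((Re \<alpha>)\<^sup>2 + (Im \<alpha>)\<^sup>2)"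
    using re by (simp add: algebra_simps power2_eq_square)
  then have "real_of_int p = of_int n * (norm \<alpha>)\<^sup>2" by (simp add: cmod_power2)
  then have pn: "\<beta> * real_of_int p = of_int n" using norm_product by (simp add: mult.left_commute)
  have "p = 0"
  proof (rule ccontr)
    assume "p \<noteq> 0"
    then have "\<beta> = of_int n / of_int p" using pn by (simp add: field_simps)
    then show False using beta_irrational by auto
  qed
  then show ?thesis using pn q by simp
qed

lemma conjugate_root_power:
  fixes x :: "'a :: comm_ring_1"
  assumes "x ^ 3 = of_nat a * x ^ 2 - x + 1"
  shows "x ^ (i + 1) = of_int (G i) + of_int (G (i + 2) - int a * G (i + 1)) * x + of_int (G (i + 1)) * x\<^sup>2"
proof (induction i)
  case (Suc i)
  have "x ^ (Suc i + 1) = x * (of_int (G i) + of_int (G (i + 2) - int a * G (i + 1)) * x + of_int (G (i + 1)) * x\<^sup>2)"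
    unfolding Suc[symmetric] by simp
  also have "\<dots> = of_int (G i) * x + of_int (G (i + 2) - int a * G (i + 1)) * x\<^sup>2 + of_int (G (i + 1)) * x ^ 3"
    by (simp add: algebra_simps power2_eq_square power3_eq_cube)
  also have "\<dots> = of_int (G (i + 1)) + of_int (G i - G (i + 1)) * x + of_int (G (i + 2)) * x\<^sup>2"
    unfolding assms by (simp add: algebra_simps)
  finally show ?case using G_rec[of i] by (simp add: numeral_eq_Suc)
qed simp

text \<open>The ring \<open>\<int>[\<alpha>]\<close>, embedded by the two field embeddings \<open>\<alpha> \<mapsto> \<alpha>\<close> and \<open>\<alpha> \<mapsto> \<beta>\<close>.  In both
embeddings together the ring is discrete, whereas each single image is dense.\<close>

definition conj_pairs :: "(complex \<times> real) set" where
  "conj_pairs = {(of_int p + of_int q * \<alpha> + of_int n * \<alpha>\<^sup>2, of_int p + of_int q * \<beta> + of_int n * \<beta>\<^sup>2) | p q n. True}"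

lemma conj_pairsI:
  "\<zeta> = of_int p + of_int q * \<alpha> + of_int n * \<alpha>\<^sup>2 \<Longrightarrow> \<rho> = of_int p + of_int q * \<beta> + of_int n * \<beta>\<^sup>2
    \<Longrightarrow> (\<zeta>, \<rho>) \<in> conj_pairs"
  unfolding conj_pairs_def by blast

lemma conj_pairsE:
  assumes "(\<zeta>, \<rho>) \<in> conj_pairs"
  obtains p q n where "\<zeta> = of_int p + of_int q * \<alpha> + of_int n * \<alpha>\<^sup>2"
    "\<rho> = of_int p + of_int q * \<beta> + of_int n * \<beta>\<^sup>2"
  using assms unfolding conj_pairs_def by blast

lemma conj_pairs_add:
  assumes "(\<zeta>, \<rho>) \<in> conj_pairs" "(\<zeta>', \<rho>') \<in> conj_pairs"
  shows "(\<zeta> + \<zeta>', \<rho> + \<rho>') \<in> conj_pairs"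
proof -
  obtain p q n where 1: "\<zeta> = of_int p + of_int q * \<alpha> + of_int n * \<alpha>\<^sup>2"
    "\<rho> = of_int p + of_int q * \<beta> + of_int n * \<beta>\<^sup>2" using assms(1) by (rule conj_pairsE)
  obtain p' q' n' where 2: "\<zeta>' = of_int p' + of_int q' * \<alpha> + of_int n' * \<alpha>\<^sup>2"
    "\<rho>' = of_int p' + of_int q' * \<beta> + of_int n' * \<beta>\<^sup>2" using assms(2) by (rule conj_pairsE)
  show ?thesis
    by (rule conj_pairsI[where p = "p + p'" and q = "q + q'" and n = "n + n'"]) (auto simp: 1 2 algebra_simps)
qed

lemma conj_pairs_minus:
  assumes "(\<zeta>, \<rho>) \<in> conj_pairs"
  shows "(- \<zeta>, - \<rho>) \<in> conj_pairs"
proof -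
  obtain p q n where 1: "\<zeta> = of_int p + of_int q * \<alpha> + of_int n * \<alpha>\<^sup>2"
    "\<rho> = of_int p + of_int q * \<beta> + of_int n * \<beta>\<^sup>2" using assms(1) by (rule conj_pairsE)
  show ?thesis by (rule conj_pairsI[where p = "- p" and q = "- q" and n = "- n"]) (auto simp: 1)
qed

lemma conj_pairs_lattice: "(of_int p + of_int q * \<alpha>, of_int p + of_int q * \<beta>) \<in> conj_pairs"
  by (rule conj_pairsI[where n = 0]) auto

lemma conj_pairs_nat: "(of_nat k, of_nat k) \<in> conj_pairs"
  using conj_pairs_lattice[of "int k" 0] by simp

text \<open>The constant term \<open>-1\<close> makes every root a unit, so that the ring is closed under division by it.\<close>

lemma root_inverse:
  fixes x :: "'a :: field"
  assumes "x \<noteq> 0" "x ^ 3 = of_nat a * x\<^sup>2 - x + 1"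
  shows "1 / x = x\<^sup>2 - of_nat a * x + 1"
proof -
  have "(x\<^sup>2 - of_nat a * x + 1) * x = 1"
    using assms(2) by (simp add: algebra_simps power2_eq_square power3_eq_cube)
  then show ?thesis using assms(1) by (metis nonzero_eq_divide_eq)
qed

lemma root_divide:
  fixes x :: "'a :: field"
  assumes "x \<noteq> 0" "x ^ 3 = of_nat a * x\<^sup>2 - x + 1"
  shows "(of_int p + of_int q * x + of_int n * x\<^sup>2) / x
    = of_int (p + q) + of_int (n - int a * p) * x + of_int p * x\<^sup>2"
proof -
  have "(of_int (p + q) + of_int (n - int a * p) * x + of_int p * x\<^sup>2) * x
     = of_int (p + q) * x + of_int n * x\<^sup>2 - of_nat a * of_int p * x\<^sup>2 + of_int p * x ^ 3"
    by (simp add: algebra_simps power2_eq_square power3_eq_cube)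
  also have "\<dots> = of_int p + of_int q * x + of_int n * x\<^sup>2"
    unfolding assms(2) by (simp add: algebra_simps)
  finally show ?thesis using assms(1) by (metis nonzero_eq_divide_eq)
qed

lemma conj_pairs_divide:
  assumes "(\<zeta>, \<rho>) \<in> conj_pairs"
  shows "(\<zeta> / \<alpha>, \<rho> / \<beta>) \<in> conj_pairs"
proof -
  obtain p q n where 1: "\<zeta> = of_int p + of_int q * \<alpha> + of_int n * \<alpha>\<^sup>2"
    "\<rho> = of_int p + of_int q * \<beta> + of_int n * \<beta>\<^sup>2" using assms(1) by (rule conj_pairsE)
  show ?thesis
    using root_divide[OF alpha_nonzero alpha_root] root_divide[of \<beta>] beta_root beta_gt
    unfolding 1 by (intro conj_pairsI[where p = "p + q" and q = "n - int a * p" and n = p]) auto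
qed

lemma conj_pairs_divide_power:
  "(\<zeta>, \<rho>) \<in> conj_pairs \<Longrightarrow> (\<zeta> / \<alpha> ^ m, \<rho> / \<beta> ^ m) \<in> conj_pairs"
proof (induction m)
  case (Suc m)
  then show ?case using conj_pairs_divide[of "\<zeta> / \<alpha> ^ m" "\<rho> / \<beta> ^ m"] by (simp add: mult.commute)
qed simp

text \<open>The imaginary part of the first conjugate bounds \<open>q + 2 n Re \<alpha>\<close>.  Once \<open>q\<close> is eliminated,
the difference of the conjugates bounds \<open>n \<bar>\<beta> - \<alpha>\<bar>\<^sup>2\<close>, hence \<open>n\<close>, then \<open>q\<close> and \<open>p\<close>.\<close>

lemma finite_bounded_conj_pairs:
  "finite {(\<zeta>, \<rho>) \<in> conj_pairs. norm \<zeta> \<le> B \<and> \<bar>\<rho>\<bar> \<le> B}"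
proof (cases "0 \<le> B")
  case False
  have "{(\<zeta>, \<rho>) \<in> conj_pairs. norm \<zeta> \<le> B \<and> \<bar>\<rho>\<bar> \<le> B} = {}"
    using False by auto
  then show ?thesis by (simp only: finite.emptyI)
next
  case True
  define x where "x = Re \<alpha>"
  define y where "y = Im \<alpha>"
  have y: "y \<noteq> 0" using Im_alpha by (simp add: y_def)
  define C where "C = B / \<bar>y\<bar>"
  define D where "D = (2 * B + C * \<bar>\<beta> - x\<bar>) / y\<^sup>2"
  define Q where "Q = C + 2 * D * \<bar>x\<bar>"
  define P where "P = B + Q * \<beta> + D * \<beta>\<^sup>2"
  define box where "box b = {- \<lceil>b\<rceil> .. \<lceil>b\<rceil>}" for b :: real
  define f :: "int \<times> int \<times> int \<Rightarrow> complex \<times> real" where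
    "f = (\<lambda>(p, q, n). (of_int p + of_int q * \<alpha> + of_int n * \<alpha>\<^sup>2, of_int p + of_int q * \<beta> + of_int n * \<beta>\<^sup>2))"
  have box: "k \<in> box b" if "\<bar>real_of_int k\<bar> \<le> b" for k b
    using that unfolding box_def by simp linarith
  have "{(\<zeta>, \<rho>) \<in> conj_pairs. norm \<zeta> \<le> B \<and> \<bar>\<rho>\<bar> \<le> B} \<subseteq> f ` (box P \<times> box Q \<times> box D)"
  proof clarify
    fix \<zeta> \<rho> assume cp: "(\<zeta>, \<rho>) \<in> conj_pairs" and B: "norm \<zeta> \<le> B" "\<bar>\<rho>\<bar> \<le> B"
    obtain p q n where e: "\<zeta> = of_int p + of_int q * \<alpha> + of_int n * \<alpha>\<^sup>2"
      "\<rho> = of_int p + of_int q * \<beta> + of_int n * \<beta>\<^sup>2" using cp by (rule conj_pairsE)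
    define t where "t = of_int q + 2 * of_int n * x"
    have "Im \<zeta> = t * y" by (simp add: e t_def x_def y_def power2_eq_square algebra_simps)
    then have "\<bar>t\<bar> * \<bar>y\<bar> \<le> B" using abs_Im_le_cmod[of \<zeta>] B by (simp add: abs_mult)
    then have t: "\<bar>t\<bar> \<le> C" using y by (simp add: C_def field_simps)
    have "\<rho> - Re \<zeta> = t * (\<beta> - x) + of_int n * ((\<beta> - x)\<^sup>2 + y\<^sup>2)"
      by (simp add: e t_def x_def y_def power2_eq_square algebra_simps)
    moreover have "\<bar>t * (\<beta> - x)\<bar> \<le> C * \<bar>\<beta> - x\<bar>" using t by (simp add: abs_mult mult_right_mono)
    moreover have "\<bar>\<rho> - Re \<zeta>\<bar> \<le> 2 * B" using abs_Re_le_cmod[of \<zeta>] B by linarith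
    ultimately have "\<bar>of_int n * ((\<beta> - x)\<^sup>2 + y\<^sup>2)\<bar> \<le> 2 * B + C * \<bar>\<beta> - x\<bar>" by linarith
    moreover have "\<bar>real_of_int n\<bar> * y\<^sup>2 \<le> \<bar>of_int n * ((\<beta> - x)\<^sup>2 + y\<^sup>2)\<bar>"
      by (simp add: abs_mult mult_left_mono)
    ultimately have "\<bar>real_of_int n\<bar> * y\<^sup>2 \<le> 2 * B + C * \<bar>\<beta> - x\<bar>" by linarith
    then have n: "\<bar>real_of_int n\<bar> \<le> D" using y by (simp add: D_def field_simps)
    have "\<bar>2 * of_int n * x\<bar> \<le> 2 * D * \<bar>x\<bar>" using n by (simp add: abs_mult mult_right_mono)
    then have q: "\<bar>real_of_int q\<bar> \<le> Q" using t unfolding t_def Q_def by linarith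
    have "\<bar>of_int q * \<beta>\<bar> \<le> Q * \<beta>" "\<bar>of_int n * \<beta>\<^sup>2\<bar> \<le> D * \<beta>\<^sup>2"
      using q n beta_gt by (auto simp: abs_mult intro!: mult_right_mono)
    then have p: "\<bar>real_of_int p\<bar> \<le> P" using B(2) unfolding P_def e(2) by linarith
    have "(\<zeta>, \<rho>) = f (p, q, n)" by (simp add: f_def e)
    moreover have "(p, q, n) \<in> box P \<times> box Q \<times> box D" using p q n box by simp
    ultimately show "(\<zeta>, \<rho>) \<in> f ` (box P \<times> box Q \<times> box D)" by blast
  qed
  moreover have "finite (f ` (box P \<times> box Q \<times> box D))" by (simp add: box_def)
  ultimately show ?thesis by (rule finite_subset)
qed

section \<open>Finite expansions\<close>

definition alpha_sum :: "(nat \<Rightarrow> nat) \<Rightarrow> nat \<Rightarrow> complex" where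
  "alpha_sum d N = (\<Sum>i=2..N. of_nat (d i) * \<alpha> ^ i)"

lemma alpha_sum_1: "alpha_sum d (Suc 0) = 0" by (simp add: alpha_sum_def)

lemma alpha_sum_Suc: "1 \<le> N \<Longrightarrow> alpha_sum d (Suc N) = alpha_sum d N + of_nat (d (Suc N)) * \<alpha> ^ Suc N"
  unfolding alpha_sum_def by (subst sum.cl_ivl_Suc) auto

text \<open>Zero digits up to \<open>k\<close> make room for joining the expansion to another one with low indices.\<close>

definition finite_above :: "nat \<Rightarrow> complex \<Rightarrow> bool" where
  "finite_above k \<zeta> \<longleftrightarrow> (\<exists>d N. admissible a d \<and> (\<forall>i\<le>k. d i = 0) \<and> (\<forall>i>N. d i = 0) \<and> \<zeta> = alpha_sum d N)"

lemma finite_above_mono: "finite_above k \<zeta> \<Longrightarrow> k' \<le> k \<Longrightarrow> finite_above k' \<zeta>"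
  unfolding finite_above_def by (blast intro: le_trans)

lemma beta_fourth: "\<beta> ^ 4 = (real a - 1) * \<beta> ^ 3 + (real a - 1) * \<beta>\<^sup>2 + 1"
proof -
  have "\<beta> ^ 4 = \<beta> * \<beta> ^ 3" by (simp add: power_numeral_reduce)
  also have "\<dots> = \<beta> * (a * \<beta>\<^sup>2 - \<beta> + 1)" by (simp only: beta_root)
  also have "\<dots> = a * \<beta> ^ 3 - \<beta>\<^sup>2 + \<beta>" by (simp add: algebra_simps power2_eq_square power3_eq_cube)
  finally show ?thesis unfolding left_diff_distrib mult_1 using beta_root by linarith
qed

text \<open>Multiplication by a root in the basis \<open>1 / x, x - a, 1\<close>, in which it acts as a shift of the
coordinates up to an integer.  That integer is the digit produced by the step, and it is the same
for every conjugate.\<close>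

lemma root_shift:
  fixes x :: "'a :: field" and u v w t :: int
  assumes "x \<noteq> 0" "x ^ 3 = of_nat a * x\<^sup>2 - x + 1"
  shows "x * (of_int u / x + of_int v * (x - of_nat a) + of_int w)
       = (of_int v / x + of_int w * (x - of_nat a) + of_int t) + of_int (u - v + int a * w - t)"
proof -
  have i: "1 / x = x\<^sup>2 - of_nat a * x + 1" by (rule root_inverse[OF assms])
  have "x * (of_int u / x + of_int v * (x - of_nat a) + of_int w)
      = of_int u + of_int v * (x\<^sup>2 - of_nat a * x + 1) - of_int v + of_int w * x"
    using assms(1) by (simp add: algebra_simps power2_eq_square)
  also have "\<dots> = of_int u + of_int v * (1 / x) - of_int v + of_int w * x" unfolding i ..
  finally show ?thesis by (simp add: algebra_simps)
qed

text \<open>In the basis of \<open>root_shift\<close> the \<open>\<beta>\<close>-transformation of \<open>\<rho> \<in> [0, 1)\<close> becomes the recursion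
of \<open>contracting_srs\<close>, whose orbits end in zero.  The digits read on the way expand \<open>\<rho>\<close> in powers
of \<open>1 / \<beta>\<close> and, with the same digits, \<open>\<zeta>\<close> in powers of \<open>1 / \<alpha>\<close>.  They obey the window condition
because all remainders are less than \<open>1\<close>, while \<open>(a - 1)(a - 1)01\<close> is the expansion of \<open>1\<close>.\<close>

lemma finite_expansion_unit_interval:
  assumes "(\<zeta>, \<rho>) \<in> conj_pairs" "0 \<le> \<rho>" "\<rho> < 1"
  shows "\<exists>K. \<forall>k\<ge>4. finite_above k (\<zeta> * \<alpha> ^ (K + k))"
proof -
  obtain p q n where e: "\<zeta> = of_int p + of_int q * \<alpha> + of_int n * \<alpha>\<^sup>2"
      "\<rho> = of_int p + of_int q * \<beta> + of_int n * \<beta>\<^sup>2" using assms(1) by (rule conj_pairsE)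
  have b0: "0 < \<beta>" using beta_gt by simp
  define r where "r = 1 / \<beta>"
  define s where "s = a - \<beta>"
  have r: "0 < r" "r \<le> 4 / 7" using beta_ge by (auto simp: r_def field_simps)
  have "s * \<beta>\<^sup>2 = \<beta> - 1" using beta_root
    by (simp add: s_def algebra_simps power2_eq_square power3_eq_cube)
  then have "s = (\<beta> - 1) / \<beta>\<^sup>2" using b0 by (simp add: field_simps)
  then have s_r: "s = r - r\<^sup>2" using b0 by (simp add: r_def field_simps power2_eq_square)
  have "0 \<le> (r - 1 / 2)\<^sup>2" by simp
  then have s14: "s \<le> 1 / 4" by (simp add: s_r power2_eq_square algebra_simps)
  have s0: "0 < s" using beta_less by (simp add: s_def)
  have sr: "s < r" using r s_r by simp
  \<comment> \<open>The coordinates of \<open>\<rho>\<close> in the basis \<open>1 / \<beta>, \<beta> - a, 1\<close> are \<open>n\<close>, \<open>q + a n\<close>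
    and the integer \<open>y\<close> below; \<open>0 \<le> \<rho> < 1\<close> determines \<open>y\<close> by the first two.\<close>
  define next_state where "next_state = (\<lambda>(x, y). (y :: int, \<lceil>s * y - r * of_int x\<rceil>))"
  define st where "st k = (next_state ^^ k) (n, q + int a * n)" for k
  define z where "z k = fst (st k)" for k
  have snd_st: "snd (st k) = z (k + 1)" for k by (simp add: z_def st_def next_state_def split_beta)
  have rec: "z (k + 2) = \<lceil>s * z (k + 1) - r * z k\<rceil>" for k
    using snd_st[of "k + 1"] snd_st[of k] by (simp add: z_def st_def next_state_def split_beta)
  have z0: "z 0 = n" "z 1 = q + int a * n" using snd_st[of 0] by (auto simp: z_def st_def)
  define tail where "tail k = z k / \<beta> + z (k + 1) * (\<beta> - a) + z (k + 2)" for k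
  define ctail where "ctail k = of_int (z k) / \<alpha> + of_int (z (k + 1)) * (\<alpha> - of_nat a) + of_int (z (k + 2))" for k
  have tail: "0 \<le> tail k" "tail k < 1" for k
  proof -
    have "tail k = z (k + 2) - (s * z (k + 1) - r * z k)"
      by (simp add: tail_def s_def r_def algebra_simps)
    then show "0 \<le> tail k" "tail k < 1" unfolding rec by linarith+
  qed
  define y where "y = p - n + int a * (q + int a * n)"
  have conv: "of_int p + of_int q * x + of_int n * x\<^sup>2
      = of_int n / x + of_int (q + int a * n) * (x - of_nat a) + of_int y"
    if "x \<noteq> 0" "x ^ 3 = of_nat a * x\<^sup>2 - x + 1" for x :: "'b :: field"
  proof -
    have "of_int n / x = of_int n * (x\<^sup>2 - of_nat a * x + 1)" using root_inverse[OF that] by (metis times_divide_eq_right mult.right_neutral)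
    then show ?thesis by (simp add: y_def algebra_simps power2_eq_square)
  qed
  have "\<rho> = n / \<beta> + (q + int a * n) * (\<beta> - a) + y" using conv[of \<beta>] beta_root b0 e by simp
  then have "s * z 1 - r * z 0 = y - \<rho>" unfolding z0 by (simp add: s_def r_def algebra_simps)
  then have "y = \<lceil>s * z 1 - r * z 0\<rceil>" using assms(2,3) by linarith
  then have y: "y = z 2" using rec[of 0] by (simp add: numeral_2_eq_2)
  have start: "ctail 0 = \<zeta>" using conv[OF alpha_nonzero alpha_root] e(1) y z0 by (simp add: ctail_def numeral_2_eq_2)
  \<comment> \<open>The digits: integer parts of \<open>\<beta>\<close> times the remainders.\<close>
  define c where "c k = z k - z (k + 1) + int a * z (k + 2) - z (k + 3)" for k
  have tail_step: "\<beta> * tail k = tail (k + 1) + c k" for k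
    using root_shift[of \<beta> "z k" "z (k + 1)" "z (k + 2)" "z (k + 3)"] beta_root b0
    by (simp add: tail_def c_def numeral_eq_Suc)
  have ctail_step: "\<alpha> * ctail k = ctail (k + 1) + of_int (c k)" for k
    using root_shift[OF alpha_nonzero alpha_root, of "z k" "z (k + 1)" "z (k + 2)" "z (k + 3)"]
    by (simp add: ctail_def c_def numeral_eq_Suc)
  have c_nonneg: "0 \<le> c k" and c_less: "c k < int a" for k
  proof -
    have "0 \<le> \<beta> * tail k" using tail b0 by simp
    then have "- 1 < real_of_int (c k)" using tail_step[of k] tail(2)[of "k + 1"] by simp
    then show "0 \<le> c k" by simp
    have "\<beta> * tail k \<le> \<beta> * 1" using tail(2)[of k] b0 by (intro mult_left_mono) auto
    then have "real_of_int (c k) < real a" using tail_step[of k] tail(1)[of "k + 1"] beta_less by simp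
    then show "c k < int a" by linarith
  qed
  have parry: "c (k + 2) = 0 \<and> c (k + 3) = 0" if "c k = int a - 1" "c (k + 1) = int a - 1" for k
  proof -
    have "\<beta> ^ 4 * tail k = \<beta> * (\<beta> * (\<beta> * (\<beta> * tail k)))" by (simp add: power_numeral_reduce)
    also have "\<dots> = c k * \<beta> ^ 3 + c (k + 1) * \<beta>\<^sup>2 + c (k + 2) * \<beta> + c (k + 3) + tail (k + 4)"
      using tail_step[of k] tail_step[of "k + 1"] tail_step[of "k + 2"] tail_step[of "k + 3"]
      by (simp add: algebra_simps power2_eq_square power3_eq_cube numeral_eq_Suc)
    finally have "\<beta> ^ 4 * tail k = (\<beta> ^ 4 - 1) + c (k + 2) * \<beta> + c (k + 3) + tail (k + 4)"
      unfolding beta_fourth that by simp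
    moreover have "\<beta> ^ 4 * tail k < \<beta> ^ 4 * 1" using tail(2)[of k] b0 by (intro mult_strict_left_mono) auto
    ultimately have lt: "c (k + 2) * \<beta> + c (k + 3) < 1" using tail(1)[of "k + 4"] by simp
    have "real_of_int (c (k + 2)) * 1 \<le> c (k + 2) * \<beta>" using c_nonneg beta_gt by (intro mult_left_mono) auto
    then have "real_of_int (c (k + 2) + c (k + 3)) < 1" using lt by simp
    then have "c (k + 2) + c (k + 3) < 1" by linarith
    then show ?thesis using c_nonneg[of "k + 2"] c_nonneg[of "k + 3"] by simp
  qed
  interpret contracting_srs s r z
    by unfold_locales (use s0 s14 sr r rec in auto)
  obtain K where "z K = 0" "z (K + 1) = 0" using orbit_reaches_zero by blast
  then have zero: "ctail K = 0" using rec[of K] by (simp add: ctail_def)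
  have "\<alpha> ^ m * ctail 0 = (\<Sum>j<m. of_int (c j) * \<alpha> ^ (m - 1 - j)) + ctail m" for m
  proof (induction m)
    case (Suc m)
    have "\<alpha> ^ Suc m * ctail 0 = (\<Sum>j<m. \<alpha> * (of_int (c j) * \<alpha> ^ (m - 1 - j))) + \<alpha> * ctail m"
      using Suc by (simp add: sum_distrib_left algebra_simps)
    also have "(\<Sum>j<m. \<alpha> * (of_int (c j) * \<alpha> ^ (m - 1 - j))) = (\<Sum>j<m. of_int (c j) * \<alpha> ^ (m - j))"
      by (intro sum.cong) (auto simp: mult.left_commute power_Suc[symmetric] Suc_diff_Suc simp del: power_Suc)
    finally show ?case by (simp add: ctail_step)
  qed simp
  from this[of K] have expansion: "\<alpha> ^ K * \<zeta> = (\<Sum>j<K. of_int (c j) * \<alpha> ^ (K - 1 - j))"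
    using zero start by simp
  have "finite_above k (\<zeta> * \<alpha> ^ (K + 1 + k))" if k: "4 \<le> k" for k
  proof -
    define d where "d i = (if k < i \<and> i \<le> k + K then nat (c (k + K - i)) else 0)" for i
    have "admissible a d"
    proof (rule admissibleI)
      fix i :: nat show "d i \<le> a - 1" using c_less[of "k + K - i"] by (auto simp: d_def)
    next
      fix i :: nat assume i: "3 \<le> i" "d i = a - 1" "d (i - 1) = a - 1"
      define j where "j = k + K - i"
      have "d i \<noteq> 0" "d (i - 1) \<noteq> 0" using i a2 by auto
      then have ik: "k < i - 1" "i \<le> k + K" by (auto simp: d_def split: if_splits)
      then have j: "k + K - i = j" "k + K - (i - 1) = j + 1" "k + K - (i - 2) = j + 2" "k + K - (i - 3) = j + 3"
        using k by (auto simp: j_def)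
      have "c j = int a - 1" "c (j + 1) = int a - 1"
      proof -
        have "k < i" "i - 1 \<le> k + K" using ik by auto
        then have "nat (c j) = a - 1" "nat (c (j + 1)) = a - 1"
          using i ik unfolding d_def j by simp_all
        then show "c j = int a - 1" "c (j + 1) = int a - 1"
          using c_nonneg[of j] c_nonneg[of "j + 1"] a2 by linarith+
      qed
      from parry[OF this] show "5 \<le> i \<and> d (i - 2) = 0 \<and> d (i - 3) = 0"
        unfolding d_def j using ik k by auto
    qed
    moreover have "\<forall>i\<le>k. d i = 0" "\<forall>i>k + K. d i = 0" by (auto simp: d_def)
    moreover have "\<zeta> * \<alpha> ^ (K + 1 + k) = alpha_sum d (k + K)"
    proof -
      have "\<zeta> * \<alpha> ^ (K + 1 + k) = (\<alpha> ^ K * \<zeta>) * \<alpha> ^ (k + 1)" by (simp add: power_add mult_ac)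
      also have "\<dots> = (\<Sum>j<K. of_int (c j) * \<alpha> ^ (k + K - j))"
        unfolding expansion sum_distrib_right
      proof (intro sum.cong refl)
        fix j assume "j \<in> {..<K}"
        then have "K - 1 - j + (k + 1) = k + K - j" by auto
        then have "\<alpha> ^ (K - 1 - j) * \<alpha> ^ (k + 1) = \<alpha> ^ (k + K - j)" by (simp only: power_add[symmetric])
        then show "of_int (c j) * \<alpha> ^ (K - 1 - j) * \<alpha> ^ (k + 1) = of_int (c j) * \<alpha> ^ (k + K - j)"
          by (simp only: mult.assoc)
      qed
      also have "\<dots> = (\<Sum>i\<in>{k<..k + K}. of_nat (d i) * \<alpha> ^ i)"
        by (rule sum.reindex_bij_witness[of _ "\<lambda>i. k + K - i" "\<lambda>j. k + K - j"])
           (auto simp: d_def c_nonneg)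
      also have "\<dots> = alpha_sum d (k + K)"
        unfolding alpha_sum_def by (rule sum.mono_neutral_left) (use k in \<open>auto simp: d_def\<close>)
      finally show ?thesis .
    qed
    ultimately show ?thesis unfolding finite_above_def by blast
  qed
  then show ?thesis by blast
qed

text \<open>The finiteness property of the base \<open>\<beta>\<close>: division by a power of \<open>\<beta>\<close> leads to the unit interval.\<close>

lemma finite_expansion_pos:
  assumes "(\<zeta>, \<rho>) \<in> conj_pairs" "0 < \<rho>"
  shows "\<exists>K. \<forall>k\<ge>4. finite_above k (\<zeta> * \<alpha> ^ (K + k))"
proof -
  obtain m where m: "\<rho> < \<beta> ^ m" using real_arch_pow[OF beta_gt] by blast
  have "(\<zeta> / \<alpha> ^ m, \<rho> / \<beta> ^ m) \<in> conj_pairs" by (rule conj_pairs_divide_power[OF assms(1)])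
  moreover have "0 \<le> \<rho> / \<beta> ^ m" "\<rho> / \<beta> ^ m < 1" using m assms(2) beta_gt by auto
  ultimately obtain K where K: "\<And>k. 4 \<le> k \<Longrightarrow> finite_above k (\<zeta> / \<alpha> ^ m * \<alpha> ^ (K + k))"
    using finite_expansion_unit_interval by blast
  have "finite_above k (\<zeta> * \<alpha> ^ (K + k))" if "4 \<le> k" for k
  proof -
    have "\<zeta> / \<alpha> ^ m * \<alpha> ^ (K + (m + k)) = \<zeta> * \<alpha> ^ (K + k)"
      using alpha_nonzero by (simp add: power_add)
    then show ?thesis using K[of "m + k"] that finite_above_mono[of "m + k" _ k] by simp
  qed
  then show ?thesis by blast
qed

lemma finite_expansion_uniform:
  "\<exists>K. \<forall>\<zeta> \<rho>. (\<zeta>, \<rho>) \<in> conj_pairs \<longrightarrow> norm \<zeta> \<le> B \<longrightarrow> \<bar>\<rho>\<bar> \<le> B \<longrightarrow> 0 < \<rho> \<longrightarrow>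
     (\<forall>k\<ge>4. finite_above k (\<zeta> * \<alpha> ^ (K + k)))"
proof -
  define Y where "Y = {(\<zeta>, \<rho>) \<in> conj_pairs. norm \<zeta> \<le> B \<and> \<bar>\<rho>\<bar> \<le> B}"
  have "\<forall>y\<in>Y. \<exists>K. 0 < snd y \<longrightarrow> (\<forall>k\<ge>4. finite_above k (fst y * \<alpha> ^ (K + k)))"
    using finite_expansion_pos by (auto simp: Y_def)
  then obtain L where L: "\<And>y k. y \<in> Y \<Longrightarrow> 0 < snd y \<Longrightarrow> 4 \<le> k \<Longrightarrow> finite_above k (fst y * \<alpha> ^ (L y + k))"
    by metis
  have fin: "finite (L ` Y)" unfolding Y_def using finite_bounded_conj_pairs by blast
  define K where "K = Max (insert 0 (L ` Y))"
  have "finite_above k (\<zeta> * \<alpha> ^ (K + k))"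
    if "(\<zeta>, \<rho>) \<in> conj_pairs" "norm \<zeta> \<le> B" "\<bar>\<rho>\<bar> \<le> B" "0 < \<rho>" "4 \<le> k" for \<zeta> \<rho> k
  proof -
    have y: "(\<zeta>, \<rho>) \<in> Y" using that by (simp add: Y_def)
    then have le: "L (\<zeta>, \<rho>) \<le> K" unfolding K_def using fin by (intro Max_ge) auto
    have "finite_above (K - L (\<zeta>, \<rho>) + k) (\<zeta> * \<alpha> ^ (L (\<zeta>, \<rho>) + (K - L (\<zeta>, \<rho>) + k)))"
      using L[OF y, of "K - L (\<zeta>, \<rho>) + k"] that by simp
    then have "finite_above (K - L (\<zeta>, \<rho>) + k) (\<zeta> * \<alpha> ^ (K + k))" using le by simp
    then show ?thesis by (rule finite_above_mono) simp
  qed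
  then show ?thesis by blast
qed

section \<open>Greedy sums modulo the lattice\<close>

lemma lattice_ptsI: "of_int p + of_int q * \<alpha> \<in> lattice_pts \<alpha>"
  unfolding lattice_pts_def by blast

lemma lattice_ptsE:
  assumes "u \<in> lattice_pts \<alpha>" obtains p q where "u = of_int p + of_int q * \<alpha>"
  using assms unfolding lattice_pts_def by blast

lemma lattice_zero: "0 \<in> lattice_pts \<alpha>"
  using lattice_ptsI[of 0 0] by simp

lemma lattice_add:
  assumes "u \<in> lattice_pts \<alpha>" "v \<in> lattice_pts \<alpha>" shows "u + v \<in> lattice_pts \<alpha>"
proof -
  obtain p q p' q' where "u = of_int p + of_int q * \<alpha>" "v = of_int p' + of_int q' * \<alpha>"
    using assms by (meson lattice_ptsE)
  then have "u + v = of_int (p + p') + of_int (q + q') * \<alpha>" by (simp add: algebra_simps)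
  then show ?thesis by (simp only: lattice_ptsI)
qed

lemma lattice_mult:
  assumes "u \<in> lattice_pts \<alpha>" shows "of_int m * u \<in> lattice_pts \<alpha>"
proof -
  obtain p q where "u = of_int p + of_int q * \<alpha>" using assms by (rule lattice_ptsE)
  then have "of_int m * u = of_int (m * p) + of_int (m * q) * \<alpha>" by (simp add: algebra_simps)
  then show ?thesis by (simp only: lattice_ptsI)
qed

lemma lattice_diff: "u \<in> lattice_pts \<alpha> \<Longrightarrow> v \<in> lattice_pts \<alpha> \<Longrightarrow> u - v \<in> lattice_pts \<alpha>"
  using lattice_add[of u "- v"] lattice_mult[of v "- 1"] by simp

text \<open>Modulo \<open>\<int> + \<int>\<alpha>\<close> every power of \<open>\<alpha>\<close> is an integer multiple of \<open>\<alpha>\<^sup>2\<close>; hence an admissible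
sum is determined by the natural number that it represents in the weights \<open>G\<close>.\<close>

lemma power_mod_lattice: "\<alpha> ^ i - of_int (G i) * \<alpha>\<^sup>2 \<in> lattice_pts \<alpha>"
proof (cases i)
  case 0
  then show ?thesis using lattice_ptsI[of 1 0] by simp
next
  case (Suc j)
  then show ?thesis using conjugate_root_power[OF alpha_root, of j]
     lattice_ptsI[of "G j" "G (j + 2) - int a * G (j + 1)"] by simp
qed

lemma alpha_sum_mod_lattice: "alpha_sum d N - of_int (G_sum d N) * \<alpha>\<^sup>2 \<in> lattice_pts \<alpha>"
proof (induction N)
  case 0
  show ?case by (simp add: alpha_sum_def G_sum_def lattice_zero)
next
  case (Suc N)
  show ?case
  proof (cases "1 \<le> N")
    case False
    then show ?thesis by (simp add: alpha_sum_def G_sum_def lattice_zero)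
  next
    case True
    have "alpha_sum d (Suc N) - of_int (G_sum d (Suc N)) * \<alpha>\<^sup>2 =
      (alpha_sum d N - of_int (G_sum d N) * \<alpha>\<^sup>2) + of_int (int (d (Suc N))) * (\<alpha> ^ Suc N - of_int (G (Suc N)) * \<alpha>\<^sup>2)"
      using True by (simp add: alpha_sum_Suc G_sum_Suc algebra_simps)
    then show ?thesis using lattice_add[OF Suc lattice_mult[OF power_mod_lattice]] by (simp only:)
  qed
qed

lemma lattice_mod_unique:
  assumes "u \<in> lattice_pts \<alpha>" "v \<in> lattice_pts \<alpha>" "u + of_int m * \<alpha>\<^sup>2 = v + of_int n * \<alpha>\<^sup>2"
  shows "m = n"
proof -
  have "u - v \<in> lattice_pts \<alpha>" using assms lattice_diff by blast
  then obtain p q where "u - v = of_int p + of_int q * \<alpha>" by (rule lattice_ptsE)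
  then have "of_int p + of_int q * \<alpha> + of_int (m - n) * \<alpha>\<^sup>2 = 0" using assms(3) by (simp add: algebra_simps)
  then show ?thesis using alpha_independent[of p q "m - n"] by simp
qed

lemma lattice_translate_unique:
  assumes "u \<in> lattice_pts \<alpha>" "v \<in> lattice_pts \<alpha>" "admissible a d" "admissible a e"
    and eq: "u + alpha_sum d N = v + alpha_sum e N"
  shows "u = v"
proof -
  define l where "l d = alpha_sum d N - of_int (G_sum d N) * \<alpha>\<^sup>2" for d
  have l: "l d \<in> lattice_pts \<alpha>" for d unfolding l_def by (rule alpha_sum_mod_lattice)
  have "(u + l d) + of_int (G_sum d N) * \<alpha>\<^sup>2 = (v + l e) + of_int (G_sum e N) * \<alpha>\<^sup>2"
    using eq by (simp add: l_def algebra_simps)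
  then have "G_sum d N = G_sum e N" using lattice_mod_unique lattice_add l assms(1,2) by blast
  then have "alpha_sum d N = alpha_sum e N"
    unfolding alpha_sum_def using greedy_expansion_unique[OF assms(3,4)] by (intro sum.cong) auto
  then show ?thesis using eq by simp
qed

section \<open>The compact set of admissible sums\<close>

lemma alpha_sum_partial: "(\<Sum>i<n. of_nat (d (i + 2)) * \<alpha> ^ (i + 2)) = alpha_sum d (n + 1)"
  by (induction n) (auto simp: alpha_sum_1 alpha_sum_Suc)

lemma G_set_iff:
  "x \<in> G_set a \<alpha> \<longleftrightarrow> (\<exists>d. admissible a d \<and> (\<lambda>N. alpha_sum d N) \<longlonglongrightarrow> x)"
proof -
  have "(\<lambda>i. of_nat (d (i + 2)) * \<alpha> ^ (i + 2)) sums x \<longleftrightarrow> (\<lambda>N. alpha_sum d N) \<longlonglongrightarrow> x" for d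
    unfolding sums_def alpha_sum_partial by (simp add: filterlim_sequentially_Suc)
  then show ?thesis unfolding G_set_def greedy_all_iff_admissible by simp
qed

definition tail_bound :: "nat \<Rightarrow> real" where
  "tail_bound N = real a / (1 - norm \<alpha>) * norm \<alpha> ^ (N + 1)"

lemma tail_bound_limit: "tail_bound \<longlonglongrightarrow> 0"
proof -
  have "(\<lambda>N. real a / (1 - norm \<alpha>) * norm \<alpha> ^ (N + 1)) \<longlonglongrightarrow> real a / (1 - norm \<alpha>) * 0"
    using norm_alpha LIMSEQ_ignore_initial_segment[OF LIMSEQ_power_zero[of "norm \<alpha>"], of 1]
    by (intro tendsto_mult tendsto_const) simp
  then show ?thesis unfolding tail_bound_def[abs_def] by simp
qed

lemma alpha_sum_tail:
  assumes d: "admissible a d" and "1 \<le> N" "N \<le> M"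
  shows "norm (alpha_sum d M - alpha_sum d N) \<le> tail_bound N"
proof -
  define x where "x = norm \<alpha>"
  have x: "0 \<le> x" "x < 1" using norm_alpha by (auto simp: x_def)
  have "norm (alpha_sum d M - alpha_sum d N) \<le> real a / (1 - x) * (x ^ (N + 1) - x ^ (M + 1))"
    using assms(3)
  proof (induction M rule: dec_induct)
    case (step M)
    have "1 \<le> M" using assms(2) step by simp
    have "norm (alpha_sum d (Suc M) - alpha_sum d N)
        \<le> norm (alpha_sum d M - alpha_sum d N) + norm (of_nat (d (Suc M)) * \<alpha> ^ Suc M)"
      unfolding alpha_sum_Suc[OF \<open>1 \<le> M\<close>] by (metis add_diff_eq add.commute diff_add_eq norm_triangle_ineq)
    also have "norm (of_nat (d (Suc M)) * \<alpha> ^ Suc M) \<le> real a * x ^ (M + 1)"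
      using admissible_digit[OF d, of "Suc M"] \<open>1 \<le> M\<close>
      by (auto simp: norm_mult norm_power x_def intro!: mult_right_mono)
    also have "real a * x ^ (M + 1) = real a / (1 - x) * (x ^ (M + 1) - x ^ (Suc M + 1))"
      using x by (simp add: field_simps)
    also have "norm (alpha_sum d M - alpha_sum d N) + \<dots>
        \<le> real a / (1 - x) * (x ^ (N + 1) - x ^ (M + 1)) + real a / (1 - x) * (x ^ (M + 1) - x ^ (Suc M + 1))"
      using step by simp
    also have "\<dots> = real a / (1 - x) * (x ^ (N + 1) - x ^ (Suc M + 1))" by (simp add: algebra_simps)
    finally show ?case by simp
  qed simp
  also have "\<dots> \<le> real a / (1 - x) * x ^ (N + 1)"
    using x by (intro mult_left_mono) auto
  finally show ?thesis by (simp add: tail_bound_def x_def)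
qed

lemma alpha_sum_tail_limit:
  assumes "admissible a d" "1 \<le> N" "(\<lambda>N. alpha_sum d N) \<longlonglongrightarrow> x"
  shows "norm (x - alpha_sum d N) \<le> tail_bound N"
proof (rule LIMSEQ_le_const2)
  show "(\<lambda>M. norm (alpha_sum d M - alpha_sum d N)) \<longlonglongrightarrow> norm (x - alpha_sum d N)"
    by (intro tendsto_norm tendsto_diff assms(3) tendsto_const)
  show "\<exists>K. \<forall>M\<ge>K. norm (alpha_sum d M - alpha_sum d N) \<le> tail_bound N"
    using alpha_sum_tail[OF assms(1,2)] by blast
qed

lemma alpha_sum_convergent:
  assumes "admissible a d"
  shows "convergent (\<lambda>N. alpha_sum d N)"
proof -
  have "summable (\<lambda>i. of_nat (d (i + 2)) * \<alpha> ^ (i + 2))"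
  proof (rule summable_comparison_test')
    show "summable (\<lambda>i. real a * norm \<alpha> ^ (i + 2))"
      using norm_alpha by (intro summable_mult summable_ignore_initial_segment summable_geometric) simp
    show "norm (of_nat (d (i + 2)) * \<alpha> ^ (i + 2)) \<le> real a * norm \<alpha> ^ (i + 2)" if "0 \<le> i" for i
      using admissible_digit[OF assms, of "i + 2"]
      unfolding norm_mult norm_power by (intro mult_right_mono) auto
  qed
  then have "convergent (\<lambda>n. alpha_sum d (n + 1))"
    by (simp only: summable_iff_convergent alpha_sum_partial)
  then show ?thesis by (simp only: convergent_Suc_iff Suc_eq_plus1[symmetric])
qed

lemma finite_sum_in_G_set:
  assumes "admissible a d" "\<forall>i>N. d i = 0"
  shows "alpha_sum d N \<in> G_set a \<alpha>"
proof -
  have const: "alpha_sum d M = alpha_sum d N" if "N \<le> M" for M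
    unfolding alpha_sum_def using that assms(2) by (intro sum.mono_neutral_right) auto
  have "(\<lambda>M. alpha_sum d M) \<longlonglongrightarrow> alpha_sum d N"
    by (intro tendsto_eventually eventually_sequentiallyI[of N] const)
  then show ?thesis using assms(1) G_set_iff by blast
qed

text \<open>Each condition involves finitely many digits, hence cuts out a closed set in the topology of
pointwise convergence.\<close>

lemma closed_admissible: "closed {d. admissible a d}"
proof -
  have c: "closed {d. P (d i) (d j) (d k) (d l)}" for P :: "nat \<Rightarrow> nat \<Rightarrow> nat \<Rightarrow> nat \<Rightarrow> bool" and i j k l :: nat
  proof -
    have "continuous_on UNIV (\<lambda>d :: nat \<Rightarrow> nat. (d i, d j, d k, d l))"
      by (intro continuous_on_Pair continuous_on_product_coordinates)
    moreover have "open S" for S :: "(nat \<times> nat \<times> nat \<times> nat) set"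
    proof (rule Topological_Spaces.openI)
      fix x assume "x \<in> S"
      obtain p q r s where x: "x = (p, q, r, s)" by (cases x)
      have "open ({p} \<times> {q} \<times> {r} \<times> {s})" by (intro open_Times open_discrete)
      then show "\<exists>T. open T \<and> x \<in> T \<and> T \<subseteq> S"
        using \<open>x \<in> S\<close> x by (intro exI[of _ "{p} \<times> {q} \<times> {r} \<times> {s}"]) auto
    qed
    then have "closed {(p, q, r, s). P p q r s}" by (simp add: closed_def)
    ultimately have "closed ((\<lambda>d :: nat \<Rightarrow> nat. (d i, d j, d k, d l)) -` {(p, q, r, s). P p q r s})"
      by (intro closed_vimage) auto
    moreover have "(\<lambda>d :: nat \<Rightarrow> nat. (d i, d j, d k, d l)) -` {(p, q, r, s). P p q r s} = {d. P (d i) (d j) (d k) (d l)}"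
      by auto
    ultimately show ?thesis by simp
  qed
  have "{d. admissible a d} = (\<Inter>i\<in>{2..}. {d. d i \<le> a - 1}) \<inter>
     (\<Inter>i\<in>{3..}. {d. d i = a - 1 \<and> d (i - 1) = a - 1 \<longrightarrow> 5 \<le> i \<and> d (i - 2) = 0 \<and> d (i - 3) = 0})"
    unfolding admissible_def by auto
  moreover have "closed \<dots>"
  proof (intro closed_Int closed_INT ballI)
    fix i :: nat
    show "closed {d :: nat \<Rightarrow> nat. d i \<le> a - 1}" using c[of "\<lambda>p _ _ _. p \<le> a - 1" i] by simp
    show "closed {d. d i = a - 1 \<and> d (i - 1) = a - 1 \<longrightarrow> 5 \<le> i \<and> d (i - 2) = 0 \<and> d (i - 3) = 0}"
      using c[of "\<lambda>p q r s. p = a - 1 \<and> q = a - 1 \<longrightarrow> 5 \<le> i \<and> r = 0 \<and> s = 0" i "i - 1" "i - 2" "i - 3"] .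
  qed
  ultimately show ?thesis by simp
qed

text \<open>The admissible sequences form a compact space by Tychonoff's theorem, and the value depends
continuously on the digits since the partial sums converge uniformly.\<close>

lemma compact_G_set: "compact (G_set a \<alpha>)"
proof -
  define D where "D = {d. admissible a d} \<inter> (\<Pi>\<^sub>E i\<in>UNIV. {..a - 1})"
  have "compactin (product_topology (\<lambda>i :: nat. euclidean) UNIV) (\<Pi>\<^sub>E i\<in>UNIV. {..a - 1})"
    by (subst compactin_PiE) (auto simp: finite_imp_compact)
  then have "compact (\<Pi>\<^sub>E i\<in>(UNIV :: nat set). {..a - 1})" by (simp add: euclidean_product_topology)
  then have "compact D" unfolding D_def using closed_admissible by (simp add: closed_Int_compact)
  define val where "val d = lim (\<lambda>N. alpha_sum d N)" for d
  have val: "(\<lambda>N. alpha_sum d N) \<longlonglongrightarrow> val d" if "admissible a d" for d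
    using alpha_sum_convergent[OF that] by (simp add: val_def convergent_LIMSEQ_iff)
  have "continuous_on D val"
  proof (rule uniform_limit_theorem)
    show "\<forall>\<^sub>F N in sequentially. continuous_on D (\<lambda>d. alpha_sum d N)"
      unfolding alpha_sum_def
      by (intro always_eventually allI continuous_intros continuous_on_of_nat continuous_on_subset[OF continuous_on_product_coordinates]) auto
    show "uniform_limit D (\<lambda>N d. alpha_sum d N) val sequentially"
    proof (rule uniform_limitI)
      fix \<epsilon> :: real assume "0 < \<epsilon>"
      then have "\<forall>\<^sub>F N in sequentially. tail_bound N < \<epsilon>"
        using order_tendstoD(2)[OF tail_bound_limit] by blast
      then show "\<forall>\<^sub>F N in sequentially. \<forall>d\<in>D. dist (alpha_sum d N) (val d) < \<epsilon>"
        using eventually_ge_at_top[of 1]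
      proof eventually_elim
        case (elim N)
        then show ?case using alpha_sum_tail_limit[OF _ elim(2) val]
          by (auto simp: D_def dist_norm norm_minus_commute intro: le_less_trans)
      qed
    qed
  qed simp
  moreover have "G_set a \<alpha> = val ` D"
  proof (intro equalityI subsetI)
    fix x assume "x \<in> G_set a \<alpha>"
    then obtain d where d: "admissible a d" "(\<lambda>N. alpha_sum d N) \<longlonglongrightarrow> x" using G_set_iff by blast
    \<comment> \<open>The letters at \<open>0\<close> and \<open>1\<close> are arbitrary in \<open>d\<close>; they must be bounded for \<open>e \<in> D\<close>.\<close>
    define e where "e i = (if 2 \<le> i then d i else 0)" for i
    have "alpha_sum e N = alpha_sum d N" for N unfolding alpha_sum_def e_def by (intro sum.cong) auto
    then have "val e = x" using d(2) by (simp add: val_def limI)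
    moreover have "admissible a e"
    proof (rule admissibleI)
      fix i :: nat assume i: "3 \<le> i" "e i = a - 1" "e (i - 1) = a - 1"
      moreover have "2 \<le> i" "2 \<le> i - 1" using i(1) by simp_all
      ultimately have "d i = a - 1" "d (i - 1) = a - 1" by (simp_all only: e_def if_True)
      then have "5 \<le> i \<and> d (i - 2) = 0 \<and> d (i - 3) = 0"
        using admissible_window[OF d(1) i(1)] by blast
      then show "5 \<le> i \<and> e (i - 2) = 0 \<and> e (i - 3) = 0" by (auto simp: e_def)
    qed (use admissible_digit[OF d(1)] in \<open>auto simp: e_def\<close>)
    moreover have "e \<in> (\<Pi>\<^sub>E i\<in>UNIV. {..a - 1})"
      using admissible_digit[OF d(1)] by (auto simp: e_def)
    ultimately show "x \<in> val ` D" unfolding D_def by blast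
  next
    fix x assume "x \<in> val ` D"
    then show "x \<in> G_set a \<alpha>" using val G_set_iff unfolding D_def by blast
  qed
  ultimately show ?thesis using compact_continuous_image[OF _ \<open>compact D\<close>] by simp
qed

section \<open>The translates cover the plane\<close>

lemma lattice_covering: "\<exists>u\<in>lattice_pts \<alpha>. norm (z - u) \<le> 1 + norm \<alpha>"
proof -
  define y where "y = Im z / Im \<alpha>"
  define x where "x = Re z - y * Re \<alpha>"
  have z: "z = of_real x + of_real y * \<alpha>" using Im_alpha by (simp add: complex_eq_iff x_def y_def)
  define u where "u = of_int \<lfloor>x\<rfloor> + of_int \<lfloor>y\<rfloor> * \<alpha>"
  have "z - u = of_real (frac x) + of_real (frac y) * \<alpha>" by (simp add: z u_def frac_def algebra_simps)
  then have "norm (z - u) \<le> \<bar>frac x\<bar> + \<bar>frac y\<bar> * norm \<alpha>"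
    by (metis norm_mult norm_of_real norm_triangle_ineq)
  also have "\<dots> \<le> 1 + 1 * norm \<alpha>" using frac_lt_1[of x] frac_lt_1[of y]
    by (intro add_mono mult_right_mono) (auto simp: less_imp_le)
  finally show ?thesis using lattice_ptsI u_def by auto
qed

lemma lattice_locally_finite: "finite {u \<in> lattice_pts \<alpha>. norm u \<le> B}"
proof -
  define C where "C = \<bar>B\<bar> / \<bar>Im \<alpha>\<bar>"
  define B' where "B' = \<bar>B\<bar> + C * \<bar>\<beta> - Re \<alpha>\<bar>"
  have "0 \<le> C" by (simp add: C_def)
  have "u \<in> fst ` {(\<zeta>, \<rho>) \<in> conj_pairs. norm \<zeta> \<le> B' \<and> \<bar>\<rho>\<bar> \<le> B'}"
    if u: "u \<in> lattice_pts \<alpha>" "norm u \<le> B" for u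
  proof -
    obtain p q where pq: "u = of_int p + of_int q * \<alpha>" using u(1) by (rule lattice_ptsE)
    define \<rho> where "\<rho> = of_int p + of_int q * \<beta>"
    have "\<bar>of_int q\<bar> * \<bar>Im \<alpha>\<bar> \<le> \<bar>B\<bar>"
      using abs_Im_le_cmod[of u] u(2) by (simp add: pq abs_mult)
    then have q: "\<bar>real_of_int q\<bar> \<le> C" using Im_alpha by (simp add: C_def field_simps)
    have "\<rho> = Re u + of_int q * (\<beta> - Re \<alpha>)" by (simp add: \<rho>_def pq algebra_simps)
    moreover have "\<bar>of_int q * (\<beta> - Re \<alpha>)\<bar> \<le> C * \<bar>\<beta> - Re \<alpha>\<bar>"
      using q by (simp add: abs_mult mult_right_mono)
    ultimately have "\<bar>\<rho>\<bar> \<le> B'" using abs_Re_le_cmod[of u] u(2) unfolding B'_def by linarith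
    moreover have "norm u \<le> B'" using u(2) mult_nonneg_nonneg[OF \<open>0 \<le> C\<close> abs_ge_zero[of "\<beta> - Re \<alpha>"]]
      unfolding B'_def by linarith
    moreover have "(u, \<rho>) \<in> conj_pairs" unfolding pq \<rho>_def by (rule conj_pairs_lattice)
    ultimately show ?thesis by force
  qed
  then have "{u \<in> lattice_pts \<alpha>. norm u \<le> B} \<subseteq> fst ` {(\<zeta>, \<rho>) \<in> conj_pairs. norm \<zeta> \<le> B' \<and> \<bar>\<rho>\<bar> \<le> B'}"
    by blast
  then show ?thesis using finite_bounded_conj_pairs finite_subset finite_imageI by blast
qed

text \<open>The lattice \<open>\<alpha> ^ k (\<int> + \<int>\<alpha>)\<close> is fine when \<open>k\<close> is large, but its points may have a negative
coefficient at \<open>\<alpha>\<^sup>2\<close>.  Adding a tiny \<open>\<alpha> ^ j\<close>, with \<open>j\<close> chosen after the lattice point, makes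
the coefficient nonnegative, and then the greedy expansion of this natural number applies.\<close>

lemma finite_points_dense:
  assumes "0 < \<epsilon>"
  shows "\<exists>u\<in>lattice_pts \<alpha>. \<exists>x\<in>G_set a \<alpha>. norm (u + x - z) < \<epsilon>"
proof -
  have lim: "(\<lambda>n. norm \<alpha> ^ n) \<longlonglongrightarrow> 0" using norm_alpha by (intro LIMSEQ_power_zero) simp
  have "0 < \<epsilon> / (2 * (1 + norm \<alpha>))" using assms by (simp add: add_pos_nonneg)
  then obtain k where "norm \<alpha> ^ k < \<epsilon> / (2 * (1 + norm \<alpha>))"
    using order_tendstoD(2)[OF lim] by (auto simp: eventually_sequentially)
  then have k: "norm \<alpha> ^ k * (1 + norm \<alpha>) < \<epsilon> / 2"
    using norm_ge_zero[of \<alpha>] by (simp add: field_simps add_pos_nonneg)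
  obtain w where w: "w \<in> lattice_pts \<alpha>" "norm (z / \<alpha> ^ k - w) \<le> 1 + norm \<alpha>"
    using lattice_covering by blast
  obtain p q where pq: "w = of_int p + of_int q * \<alpha>" using w(1) by (rule lattice_ptsE)
  have "z - \<alpha> ^ k * w = \<alpha> ^ k * (z / \<alpha> ^ k - w)" using alpha_nonzero by (simp add: algebra_simps)
  then have "norm (z - \<alpha> ^ k * w) \<le> norm \<alpha> ^ k * (1 + norm \<alpha>)"
    using w(2) by (simp add: norm_mult norm_power mult_left_mono)
  then have near: "norm (z - \<alpha> ^ k * w) < \<epsilon> / 2" using k by simp
  define c where "c = p * G k + q * G (k + 1)"
  obtain J where J: "\<And>j. J \<le> j \<Longrightarrow> norm \<alpha> ^ j < \<epsilon> / 2"
    using order_tendstoD(2)[OF lim, of "\<epsilon> / 2"] assms by (auto simp: eventually_sequentially)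
  define j where "j = max J (nat \<bar>c\<bar>) + 1"
  have "0 \<le> c + G j" using G_unbounded[of "j - 1"] by (simp add: j_def)
  then obtain d N where d: "admissible a d" "\<forall>i>N. d i = 0" "G_sum d N = c + G j"
    using greedy_expansion_exists by blast
  define x where "x = alpha_sum d N"
  define l where "l i = \<alpha> ^ i - of_int (G i) * \<alpha>\<^sup>2" for i
  have l: "l i \<in> lattice_pts \<alpha>" for i unfolding l_def by (rule power_mod_lattice)
  define v where "v = x - of_int (c + G j) * \<alpha>\<^sup>2"
  have v: "v \<in> lattice_pts \<alpha>" using alpha_sum_mod_lattice[of d N] d(3) by (simp add: v_def x_def)
  define u where "u = of_int p * l k + of_int q * l (k + 1) + l j - v"
  have "u \<in> lattice_pts \<alpha>" unfolding u_def
    by (intro lattice_diff lattice_add lattice_mult l v)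
  have "x \<in> G_set a \<alpha>" unfolding x_def by (rule finite_sum_in_G_set[OF d(1,2)])
  have "u + x = \<alpha> ^ k * w + \<alpha> ^ j"
    by (simp add: u_def v_def l_def pq c_def algebra_simps)
  then have "norm (u + x - z) \<le> norm (z - \<alpha> ^ k * w) + norm \<alpha> ^ j"
    using norm_triangle_ineq[of "\<alpha> ^ k * w - z" "\<alpha> ^ j"]
    by (simp add: norm_power norm_minus_commute algebra_simps)
  moreover have "norm \<alpha> ^ j < \<epsilon> / 2" by (rule J) (simp add: j_def)
  ultimately have "norm (u + x - z) < \<epsilon>" using near by linarith
  with \<open>u \<in> lattice_pts \<alpha>\<close> \<open>x \<in> G_set a \<alpha>\<close> show ?thesis by blast
qed

lemma translate_iff: "z \<in> translate S u \<longleftrightarrow> z - u \<in> S"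
  unfolding translate_def by (force simp: image_iff algebra_simps)

text \<open>Near a given point only finitely many translates matter, and their union is closed, so density of
the finite points suffices.\<close>

lemma translates_cover: "(\<Union>u\<in>lattice_pts \<alpha>. translate (G_set a \<alpha>) u) = UNIV"
proof (intro equalityI subsetI UNIV_I)
  fix z :: complex
  obtain R where R: "\<And>x. x \<in> G_set a \<alpha> \<Longrightarrow> norm x \<le> R"
    using compact_imp_bounded[OF compact_G_set] by (auto simp: bounded_iff)
  define U where "U = {u \<in> lattice_pts \<alpha>. norm u \<le> norm z + R + 1}"
  define F where "F = (\<Union>u\<in>U. translate (G_set a \<alpha>) u)"
  have "closed F" unfolding F_def U_def
    by (intro closed_UN lattice_locally_finite ballI)
       (auto simp: translate_def closed_translation_subtract intro!: compact_imp_closed compact_continuous_image compact_G_set continuous_intros)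
  moreover have "z \<in> closure F"
  proof (unfold closure_approachable, intro allI impI)
    fix \<epsilon> :: real assume "0 < \<epsilon>"
    then obtain u x where ux: "u \<in> lattice_pts \<alpha>" "x \<in> G_set a \<alpha>" "norm (u + x - z) < min \<epsilon> 1"
      using finite_points_dense[of "min \<epsilon> 1" z] by auto
    have "norm u \<le> norm (u + x - z) + norm z + norm x"
      using norm_triangle_ineq4[of "(u + x - z) + z" x] norm_triangle_ineq[of "u + x - z" z] by simp
    then have "u \<in> U" using ux R[OF ux(2)] by (simp add: U_def)
    then have "u + x \<in> F" using ux unfolding F_def by (intro UN_I[of u]) (auto simp: translate_iff)
    then show "\<exists>y\<in>F. dist y z < \<epsilon>" using ux(3) by (auto simp: dist_norm)
  qed
  ultimately have "z \<in> F" by simp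
  then show "z \<in> (\<Union>u\<in>lattice_pts \<alpha>. translate (G_set a \<alpha>) u)" by (auto simp: F_def U_def)
qed

section \<open>Finite points lie in a single translate\<close>

definition beta_sum :: "(nat \<Rightarrow> nat) \<Rightarrow> nat \<Rightarrow> real" where
  "beta_sum d N = (\<Sum>i=2..N. real (d i) * \<beta> ^ i)"

lemma beta_sum_Suc: "1 \<le> N \<Longrightarrow> beta_sum d (Suc N) = beta_sum d N + real (d (Suc N)) * \<beta> ^ Suc N"
  unfolding beta_sum_def by (subst sum.cl_ivl_Suc) auto

lemma beta_sum_unbounded:
  assumes "\<And>M. \<exists>i>M. d i \<noteq> 0"
  shows "\<exists>M. \<forall>N\<ge>M. B < beta_sum d N"
proof -
  obtain m where m: "B < \<beta> ^ m" using real_arch_pow[OF beta_gt] by blast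
  obtain i where i: "m + 2 < i" "d i \<noteq> 0" using assms by blast
  have "B < beta_sum d N" if "i \<le> N" for N
  proof -
    have "\<beta> ^ m \<le> 1 * \<beta> ^ i" using i beta_gt by simp
    also have "\<dots> \<le> real (d i) * \<beta> ^ i" using i beta_gt by (intro mult_right_mono) auto
    also have "\<dots> \<le> beta_sum d N" unfolding beta_sum_def
      using i that beta_gt by (intro member_le_sum) auto
    finally show ?thesis using m by simp
  qed
  then show ?thesis by blast
qed

lemma conj_pair_sums: "(alpha_sum d N, beta_sum d N) \<in> conj_pairs"
proof -
  have pow: "(\<alpha> ^ i, \<beta> ^ i) \<in> conj_pairs" for i
  proof (cases i)
    case 0 then show ?thesis using conj_pairs_nat[of 1] by simp
  next
    case (Suc j)
    show ?thesis
      using conjugate_root_power[OF alpha_root, of j] conjugate_root_power[of \<beta> j] beta_root Suc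
      by (intro conj_pairsI[where p = "G j" and q = "G (j + 2) - int a * G (j + 1)" and n = "G (j + 1)"]) auto
  qed
  have mult: "(of_nat m * \<zeta>, of_nat m * \<rho>) \<in> conj_pairs" if "(\<zeta>, \<rho>) \<in> conj_pairs" for m \<zeta> \<rho>
    using that
  proof (induction m)
    case 0 show ?case using conj_pairs_nat[of 0] by simp
  next
    case (Suc m) then show ?case using conj_pairs_add[OF Suc.prems Suc.IH] by (simp add: algebra_simps)
  qed
  show ?thesis
  proof (induction N)
    case 0 show ?case using conj_pairs_nat[of 0] by (simp add: alpha_sum_def beta_sum_def)
  next
    case (Suc N)
    show ?case
    proof (cases "1 \<le> N")
      case True
      show ?thesis unfolding alpha_sum_Suc[OF True] beta_sum_Suc[OF True]
        by (rule conj_pairs_add[OF Suc mult[OF pow]])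
    next
      case False
      then show ?thesis using conj_pairs_nat[of 0] by (simp add: alpha_sum_def beta_sum_def)
    qed
  qed
qed

text \<open>Let a finite sum in the translate by \<open>v\<close> equal an infinite sum in the translate by \<open>u\<close>.  The
differences between the partial sums of the latter and the point, divided by \<open>\<alpha> ^ (N + 1)\<close>, are
bounded together with their conjugates, so they take finitely many values.  Positive ones have
finite expansions of uniformly bounded length \<open>K\<close>.  Multiplied back, such an expansion only uses
indices far above those of the finite sum, so both sides become finite admissible sums plus lattice
points, and \<open>lattice_translate_unique\<close> applies.\<close>

lemma finite_point_exclusive:
  assumes uv: "u \<in> lattice_pts \<alpha>" "v \<in> lattice_pts \<alpha>"
    and d: "admissible a d" and e: "admissible a e"
    and lim: "(\<lambda>N. u + alpha_sum e N) \<longlonglongrightarrow> v + alpha_sum d M"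
  shows "u = v"
proof (cases "\<forall>m. \<exists>i>m. e i \<noteq> 0")
  case False
  then obtain m where m: "\<And>i. m < i \<Longrightarrow> e i = 0" by auto
  define N where "N = max m M"
  \<comment> \<open>Only finitely many nonzero digits: both sides are finite admissible sums already.\<close>
  define d' where "d' i = (if i \<le> M then d i else 0)" for i
  have const: "alpha_sum e k = alpha_sum e N" if "N \<le> k" for k
    unfolding alpha_sum_def using that m by (intro sum.mono_neutral_right) (auto simp: N_def)
  have "(\<lambda>k. u + alpha_sum e k) \<longlonglongrightarrow> u + alpha_sum e N"
    by (intro tendsto_add tendsto_const tendsto_eventually eventually_sequentiallyI[of N] const)
  then have "u + alpha_sum e N = v + alpha_sum d M" using lim LIMSEQ_unique by blast
  also have "alpha_sum d M = alpha_sum d' N"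
    unfolding alpha_sum_def d'_def by (rule sum.mono_neutral_cong_left) (auto simp: N_def)
  finally show ?thesis
    using lattice_translate_unique[OF uv e] admissible_truncate[OF a2 d, of M] unfolding d'_def by blast
next
  case True
  obtain p q where u: "u = of_int p + of_int q * \<alpha>" using uv(1) by (rule lattice_ptsE)
  obtain p' q' where v: "v = of_int p' + of_int q' * \<alpha>" using uv(2) by (rule lattice_ptsE)
  define x where "x = v + alpha_sum d M - u"
  define x' where "x' = (of_int p' + of_int q' * \<beta>) + beta_sum d M - (of_int p + of_int q * \<beta>)"
  have x: "(x, x') \<in> conj_pairs"
    unfolding x_def x'_def u v diff_conv_add_uminus
    by (intro conj_pairs_add conj_pairs_minus conj_pairs_lattice conj_pair_sums)
  have elim: "(\<lambda>N. alpha_sum e N) \<longlonglongrightarrow> x"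
    using tendsto_diff[OF lim tendsto_const[of u]] by (simp add: x_def algebra_simps)
  define \<zeta> where "\<zeta> N = (alpha_sum e N - x) / \<alpha> ^ (N + 1)" for N
  define \<rho> where "\<rho> N = (beta_sum e N - x') / \<beta> ^ (N + 1)" for N
  have pairs: "(\<zeta> N, \<rho> N) \<in> conj_pairs" for N
    unfolding \<zeta>_def \<rho>_def diff_conv_add_uminus
    by (intro conj_pairs_divide_power conj_pairs_add conj_pairs_minus conj_pair_sums x)
  have norm_zeta: "norm (\<zeta> N) \<le> a / (1 - norm \<alpha>)" if "1 \<le> N" for N
    using alpha_sum_tail_limit[OF e that elim] alpha_nonzero
    by (simp add: \<zeta>_def tail_bound_def norm_divide norm_mult norm_power norm_minus_commute divide_le_eq mult.commute)
  define R where "R = max \<bar>\<rho> 1\<bar> (a / (\<beta> - 1))"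
  have rho: "\<bar>\<rho> N\<bar> \<le> R" if "1 \<le> N" for N
    using that
  proof (induction N rule: dec_induct)
    case (step N)
    have "\<rho> (Suc N) = (\<rho> N + real (e (Suc N))) / \<beta>"
      using beta_gt step by (simp add: \<rho>_def beta_sum_Suc field_simps)
    then have "\<bar>\<rho> (Suc N)\<bar> \<le> (R + a) / \<beta>"
      using step admissible_digit[OF e, of "Suc N"] beta_gt
      by (auto intro!: divide_right_mono order_trans[OF abs_triangle_ineq])
    also have "a / (\<beta> - 1) \<le> R" by (simp add: R_def)
    then have "(R + a) / \<beta> \<le> R" using beta_gt by (simp add: field_simps)
    finally show ?case .
  qed (simp add: R_def)
  define B where "B = max R (a / (1 - norm \<alpha>))"
  obtain K where K: "\<And>\<zeta> \<rho> k. (\<zeta>, \<rho>) \<in> conj_pairs \<Longrightarrow> norm \<zeta> \<le> B \<Longrightarrow> \<bar>\<rho>\<bar> \<le> B \<Longrightarrow> 0 < \<rho> \<Longrightarrow> 4 \<le> k \<Longrightarrow>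
      finite_above k (\<zeta> * \<alpha> ^ (K + k))"
    using finite_expansion_uniform[of B] by blast
  \<comment> \<open>The expansion exists for positive elements only; the conjugates \<open>\<rho> N\<close> are eventually positive
    since infinitely many digits of \<open>e\<close> are nonzero.\<close>
  obtain N0 where N0: "\<And>N. N0 \<le> N \<Longrightarrow> x' < beta_sum e N" using beta_sum_unbounded[of e x'] True by blast
  define N where "N = max N0 (K + M + 4)"
  have "1 \<le> N" by (simp add: N_def)
  have "0 < \<rho> N" using N0[of N] beta_gt by (simp add: \<rho>_def N_def)
  then have "finite_above (N + 1 - K) (\<zeta> N * \<alpha> ^ (K + (N + 1 - K)))"
    using norm_zeta[OF \<open>1 \<le> N\<close>] rho[OF \<open>1 \<le> N\<close>] by (intro K[OF pairs]) (auto simp: B_def N_def)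
  moreover have "K + (N + 1 - K) = N + 1" "M + 4 \<le> N + 1 - K" by (auto simp: N_def)
  ultimately have "finite_above (M + 4) (\<zeta> N * \<alpha> ^ (N + 1))" using finite_above_mono by metis
  then obtain f L where f: "admissible a f" "\<And>i. i \<le> M + 4 \<Longrightarrow> f i = 0" "\<And>i. L < i \<Longrightarrow> f i = 0"
    and fs: "alpha_sum e N - x = alpha_sum f L"
    using alpha_nonzero unfolding finite_above_def \<zeta>_def by auto
  define T where "T = max (max N M) L"
  define g where "g i = (if i \<le> M then d i else f i)" for i
  define e' where "e' i = (if i \<le> N then e i else 0)" for i
  define d' where "d' i = (if i \<le> M then d i else 0)" for i
  have "alpha_sum e N = alpha_sum e' T"
    unfolding alpha_sum_def e'_def by (rule sum.mono_neutral_cong_left) (auto simp: T_def)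
  moreover have "alpha_sum d M = alpha_sum d' T"
    unfolding alpha_sum_def d'_def by (rule sum.mono_neutral_cong_left) (auto simp: T_def)
  moreover have "alpha_sum f L = alpha_sum f T"
    unfolding alpha_sum_def by (rule sum.mono_neutral_left) (auto simp: T_def f)
  moreover have "alpha_sum d' T + alpha_sum f T = alpha_sum g T"
    unfolding alpha_sum_def sum.distrib[symmetric] using f(2)
    by (intro sum.cong) (auto simp: d'_def g_def)
  ultimately have "u + alpha_sum e' T = v + alpha_sum g T"
    using fs by (simp add: x_def algebra_simps)
  moreover have "admissible a e'" unfolding e'_def by (rule admissible_truncate[OF a2 e])
  moreover have "admissible a g" unfolding g_def by (rule admissible_concat[OF a2 d f(1,2)])
  ultimately show ?thesis using lattice_translate_unique[OF uv] by blast
qed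

text \<open>An open set that meets a tile contains a finite sum of that tile, by truncation.\<close>

lemma interior_meets_only_itself:
  assumes uv: "u \<in> lattice_pts \<alpha>" "v \<in> lattice_pts \<alpha>"
    and z: "z \<in> interior (translate (G_set a \<alpha>) u)" "z \<in> translate (G_set a \<alpha>) v"
  shows "u = v"
proof -
  obtain d where d: "admissible a d" "(\<lambda>N. alpha_sum d N) \<longlonglongrightarrow> z - v"
    using z(2) unfolding translate_iff G_set_iff by blast
  have "(\<lambda>N. v + alpha_sum d N) \<longlonglongrightarrow> z" using tendsto_add[OF tendsto_const[of v] d(2)] by simp
  then have "\<forall>\<^sub>F N in sequentially. v + alpha_sum d N \<in> interior (translate (G_set a \<alpha>) u)"
    using z(1) by (intro topological_tendstoD) auto
  then obtain M where "v + alpha_sum d M \<in> interior (translate (G_set a \<alpha>) u)"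
    by (auto simp: eventually_sequentially)
  then have "v + alpha_sum d M - u \<in> G_set a \<alpha>"
    using interior_subset translate_iff by blast
  then obtain e where e: "admissible a e" "(\<lambda>N. alpha_sum e N) \<longlonglongrightarrow> v + alpha_sum d M - u"
    using G_set_iff by blast
  have "(\<lambda>N. u + alpha_sum e N) \<longlonglongrightarrow> v + alpha_sum d M"
    using tendsto_add[OF tendsto_const[of u] e(2)] by simp
  then show ?thesis by (rule finite_point_exclusive[OF uv d(1) e(1)])
qed

end

section \<open>The periodic tiling\<close>

theorem theorem3p1:
  fixes a :: nat and \<beta> :: real and \<alpha> \<gamma> :: complex
  assumes "a \<ge> 2"
    and "[: -1, 1, - of_nat a, 1 :] = [: - of_real \<beta>, 1 :] * [: - \<alpha>, 1 :] * [: - \<gamma>, 1 :]"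
    and "\<beta> > 1"
    and "\<alpha> \<notin> \<real>" and "\<gamma> \<notin> \<real>" and "\<gamma> = cnj \<alpha>"
    and "norm \<alpha> < 1"
  shows "(UNIV :: complex set) = (\<Union>u\<in>lattice_pts \<alpha>. translate (G_set a \<alpha>) u) \<and>
         (\<forall>u\<in>lattice_pts \<alpha>. \<forall>v\<in>lattice_pts \<alpha>.
            interior (translate (G_set a \<alpha>) u) \<inter> translate (G_set a \<alpha>) v \<noteq> {} \<longrightarrow> u = v)"
proof -
  have root: "x ^ 3 = of_nat a * x\<^sup>2 - x + 1" if "x = of_real \<beta> \<or> x = \<alpha>" for x
  proof -
    have "poly ([: - of_real \<beta>, 1 :] * [: - \<alpha>, 1 :] * [: - \<gamma>, 1 :]) x = 0"
      unfolding poly_mult using that by auto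
    then have "poly [: -1, 1, - of_nat a, 1 :] x = 0" by (simp only: assms(2))
    then have "(x ^ 3 - (of_nat a * x\<^sup>2 - x + 1)) = 0"
      by (simp add: algebra_simps power2_eq_square power3_eq_cube)
    then show ?thesis by simp
  qed
  have "complex_of_real (\<beta> ^ 3) = of_real (real a * \<beta>\<^sup>2 - \<beta> + 1)"
    using root[of "of_real \<beta>"] by simp
  then have beta: "\<beta> ^ 3 = real a * \<beta>\<^sup>2 - \<beta> + 1" by (simp only: of_real_eq_iff)
  have alpha: "\<alpha> ^ 3 = of_nat a * \<alpha>\<^sup>2 - \<alpha> + 1" using root[of \<alpha>] by simp
  have "poly [: -1, 1, - of_nat a, 1 :] 0 = poly ([: - of_real \<beta>, 1 :] * [: - \<alpha>, 1 :] * [: - \<gamma>, 1 :]) 0"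
    by (simp only: assms(2))
  then have "of_real \<beta> * (\<alpha> * cnj \<alpha>) = 1" by (simp add: assms(6) algebra_simps)
  then have "complex_of_real (\<beta> * (norm \<alpha>)\<^sup>2) = of_real 1"
    by (simp only: of_real_mult complex_norm_square of_real_1)
  then have prod: "\<beta> * (norm \<alpha>)\<^sup>2 = 1" by (simp only: of_real_eq_iff)
  interpret cubic a \<beta> \<alpha>
    by unfold_locales (use assms beta alpha prod in auto)
  show ?thesis using translates_cover interior_meets_only_itself by blast
qed

end
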